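(* Let $k\ge 4$ be an integer and put $N:=k-2$. Then $$\mathfrak v_k=k(k-1)^2\int_0^{1/2}\sum_{j=0}^{N}(-1)^j\binom Nj\bigl[1-(j+2)t-(N-j)\psi_k(t)\bigr]_+^N\,\mathrm dt .$$ There is a unique $c_*>0$ satisfying $$\frac{1-e^{-c_*}}{c_*}=1-\frac{c_*}{e^{c_*}-1}.$$ With $$\Lambda_*:=\log c_*-c_*-1+\frac{1-e^{-c_*}}{c_*},\qquad \beta_*:=e^{\Lambda_*},$$ one has $$\lim_{k\to\infty}\frac{\log\mathfrak v_k}{k}=\Lambda_*,\qquad \lim_{k\to\infty}\mathfrak v_k^{1/k}=\beta_*.$$ Equivalently, $\mathfrak v_k=\exp((\Lambda_*+o(1))k)$. Numerically, by external evaluation of the saddle equations (the accompanying Lean formalization certifies the exact limits defined through the saddle point $c_*$, not these decimal digits), $$c_*=1.392614330471526\ldots,\qquad \Lambda_*=-1.521745139795282\ldots,\qquad \beta_*=0.218330536985878\ldots.$$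
   Context: For an integer $k\ge 2$ and $t\in[0,1]$ put $\psi_k(t):=\dfrac{1-t-(1-t)^k}{k-1}$. For a probability law $p$ on $k$ points, let $p_1^{\downarrow}\ge\cdots\ge p_k^{\downarrow}$ be its atoms sorted in decreasing order. Let $\Delta_{k-1}$ be the probability simplex on $k$ points, and let $\mathcal B_k\subset\Delta_{k-1}$ be the set of laws $p$ with $p_k^{\downarrow}\ge\psi_k(p_2^{\downarrow})$. Put $$\mathfrak v_k:=\frac{\operatorname{vol}_{k-1}(\mathcal B_k)}{\operatorname{vol}_{k-1}(\Delta_{k-1})},$$ the fraction of the probability simplex occupied by $\mathcal B_k$, where $\operatorname{vol}_{k-1}$ is $(k-1)$-dimensional relative volume (the ratio is independent of the affine coordinate chart used; e.g. one may drop one coordinate and use Lebesgue measure on $\mathbb R^{k-1}$). Write $[x]_+:=\max\{x,0\}$. *)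

theory Defs
  imports "HOL-Analysis.Analysis" "HOL-Library.Landau_Symbols"
begin

definition psi :: "nat \<Rightarrow> real \<Rightarrow> real" where
  "psi k t = (1 - t - (1 - t) ^ k) / (real k - 1)"

(* Laws on the k points 0, ..., k - 1. Extensionality fixes the values outside {..<k},
   so that a law is determined by its k atoms. *)
definition prob_simplex :: "nat \<Rightarrow> (nat \<Rightarrow> real) set" where
  "prob_simplex k = {p \<in> extensional {..<k}. (\<forall>i<k. 0 \<le> p i) \<and> (\<Sum>i<k. p i) = 1}"

(* The j-th largest atom, counted with multiplicity, for 1 \<le> j \<le> k. *)
definition sorted_atom :: "nat \<Rightarrow> (nat \<Rightarrow> real) \<Rightarrow> nat \<Rightarrow> real" where
  "sorted_atom k p j = rev (sort (map p [0..<k])) ! (j - 1)"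

definition B_set :: "nat \<Rightarrow> (nat \<Rightarrow> real) set" where
  "B_set k = {p \<in> prob_simplex k. sorted_atom k p k \<ge> psi k (sorted_atom k p 2)}"

(* (k - 1)-dimensional volume of a subset of the simplex, read in the affine chart that drops
   the last of the k coordinates. Another affine chart only rescales it by a constant, which
   cancels in the ratio below. *)
definition chart_volume :: "nat \<Rightarrow> (nat \<Rightarrow> real) set \<Rightarrow> real" where
  "chart_volume k A =
     measure (\<Pi>\<^sub>M i\<in>{..<k - 1}. lborel) ((\<lambda>p. restrict p {..<k - 1}) ` A)"

definition vol_frac :: "nat \<Rightarrow> real" where
  "vol_frac k = chart_volume k (B_set k) / chart_volume k (prob_simplex k)"

end

theory Submission
  imports Defs
begin

text \<open>
  Condition on the second largest atom t. By symmetry every choice of the index carrying the largest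
  atom and of the index carrying the second largest atom contributes the same volume, so the volume
  of the set is k (k - 1) times the integral over t of the volume of one slice: the other k - 2
  atoms range over the cube with side [psi k t, t], and the largest atom, being what remains of the
  total mass, is at least t exactly if those k - 2 atoms add up to at most 1 - 2 t
  (lemma \<open>emeasure_ranked_dropped\<close>). The volume of a cube cut by such a half-space is the
  alternating binomial sum of truncated powers (\<open>emeasure_box_slice\<close>), and the simplex has
  volume 1 / (k - 1)!. This is the exact formula.

  For the growth rate, t is of order 1 / k. With t = x / k the rescaled slice is the cube with side
  [1 - exp (- x), x] cut at mean about 1, and Stirling's formula contributes exp (- k). The
  exponential rate of the slice is a minimax: the supremum over x of the infimum over l of
  l + ln (integral of exp (- l u) for u from 1 - exp (- x) to x). Stationarity in x gives
  l = c / (c - a) with a = 1 - exp (- c), and stationarity in l says that the density proportional to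
  exp (- l u) on [a, c] has mean 1. Eliminating l yields the equation for c, and the value of the
  minimax is ln c - c + a / c.

  For the upper bound the infimum over l is not needed: the single multiplier l = lam of the saddle
  point already works for every x, because the integral of exp (- lam u) over
  [1 - exp (- x), x] is increasing in x up to c and decreasing afterwards (\<open>tilt_mass_le\<close>). So a
  Chernoff bound, uniform in t, suffices (\<open>slice_le\<close>). For the lower bound one restricts t to a
  short interval just below c / k, where all slices contain a fixed cube [a, C] with C < c.
  There the tilted mean is strictly below 1, so the tilted mass concentrates inside the
  half-space (\<open>boxvol_lower\<close>); then C tends to c.

  The decimal digits follow from monotonicity: both sides of the saddle equation are compared at two
  rational points enclosing c, the rate is decreasing in c, and the exponentials involved are
  enclosed by Taylor polynomials.
\<close>

section \<open>Volume of a cube cut by a half-space\<close>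

text \<open>
  Inclusion-exclusion over the set of coordinates that exceed \<open>b\<close>, starting from the corner
  \<open>x \<ge> a\<close> of the half-space with coordinate sum at most \<open>s\<close>.
\<close>
definition boxvol :: "nat \<Rightarrow> real \<Rightarrow> real \<Rightarrow> real \<Rightarrow> real" where
  "boxvol m a b s =
     (\<Sum>j\<le>m. (-1) ^ j * real (m choose j) * max (s - (real m - real j) * a - real j * b) 0 ^ m) / fact m"

text \<open>
  The bound on \<open>m\<close> keeps the kink at 0 differentiable.
\<close>
lemma DERIV_max_0_power:
  fixes x :: real
  assumes "m \<ge> 1"
  shows "((\<lambda>x. max x 0 ^ Suc m) has_real_derivative (real (Suc m) * max x 0 ^ m)) (at x)"
proof -
  consider "x > 0" | "x < 0" | "x = 0" by linarith
  then show ?thesis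
  proof cases
    case 1
    have "((\<lambda>x. x ^ Suc m) has_real_derivative (real (Suc m) * x ^ m)) (at x)"
      using DERIV_pow[of "Suc m" x] by simp
    moreover have "\<forall>\<^sub>F y in nhds x. y ^ Suc m = max y 0 ^ Suc m"
      using eventually_nhds_in_open[of "{0<..}" x] 1 by (auto elim!: eventually_mono)
    ultimately show ?thesis using 1 by (subst (asm) DERIV_cong_ev) auto
  next
    case 2
    have "((\<lambda>x. 0) has_real_derivative 0) (at x)" by simp
    moreover have "\<forall>\<^sub>F y in nhds x. 0 = max y 0 ^ Suc m"
      using eventually_nhds_in_open[of "{..<0}" x] 2 by (auto elim!: eventually_mono)
    ultimately show ?thesis using 2 assms by (subst (asm) DERIV_cong_ev) (auto simp: power_0_left)
  next
    case 3
    have "(\<lambda>h::real. max h 0 ^ Suc m / h) \<midarrow>0\<rightarrow> 0"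
    proof (rule Lim_null_comparison)
      show "\<forall>\<^sub>F h in at 0. norm (max h 0 ^ Suc m / h) \<le> max h (0::real) ^ m"
        by (rule always_eventually) (auto simp: max_def)
      have "((\<lambda>h. max h (0::real) ^ m) \<longlongrightarrow> max 0 0 ^ m) (at 0)"
        by (intro tendsto_intros)
      then show "((\<lambda>h. max h (0::real) ^ m) \<longlongrightarrow> 0) (at 0)" using assms by (simp add: power_0_left)
    qed
    then show ?thesis using 3 assms by (simp add: DERIV_def power_0_left)
  qed
qed

text \<open>
  Pascal's rule. It identifies the difference of the boundary terms of the antiderivative of an
  \<open>m\<close>-dimensional volume with an \<open>(m + 1)\<close>-dimensional one.
\<close>
lemma sum_binomial_diff:
  fixes g :: "nat \<Rightarrow> real"
  shows "(\<Sum>j\<le>Suc m. (-1) ^ j * real (Suc m choose j) * g j)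
       = (\<Sum>j\<le>m. (-1) ^ j * real (m choose j) * (g j - g (Suc j)))"
proof -
  have "(\<Sum>j\<le>Suc m. (-1) ^ j * real (Suc m choose j) * g j)
      = g 0 + (\<Sum>j\<le>m. (-1) ^ Suc j * real (Suc m choose Suc j) * g (Suc j))"
    by (subst sum.atMost_Suc_shift) simp
  also have "(\<Sum>j\<le>m. (-1) ^ Suc j * real (Suc m choose Suc j) * g (Suc j))
      = (\<Sum>j\<le>m. (-1) ^ Suc j * real (m choose j) * g (Suc j))
      + (\<Sum>j\<le>m. (-1) ^ Suc j * real (m choose Suc j) * g (Suc j))"
    by (subst sum.distrib[symmetric], rule sum.cong) (simp_all add: algebra_simps)
  also have "(\<Sum>j\<le>m. (-1) ^ Suc j * real (m choose Suc j) * g (Suc j))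
      = (\<Sum>j\<le>Suc m. (-1) ^ j * real (m choose j) * g j) - g 0"
    by (simp add: sum.atMost_Suc_shift del: sum.atMost_Suc)
  also have "(\<Sum>j\<le>Suc m. (-1) ^ j * real (m choose j) * g j) = (\<Sum>j\<le>m. (-1) ^ j * real (m choose j) * g j)"
    by simp
  finally show ?thesis by (simp add: algebra_simps sum.distrib sum_negf sum_subtractf)
qed

lemma continuous_on_boxvol [continuous_intros]:
  "continuous_on S f \<Longrightarrow> continuous_on S g \<Longrightarrow> continuous_on S h \<Longrightarrow>
    continuous_on S (\<lambda>x. boxvol m (f x) (g x) (h x))"
  unfolding boxvol_def by (intro continuous_intros) auto

lemma borel_measurable_boxvol [measurable (raw)]:
  assumes [measurable]: "f \<in> borel_measurable M" "g \<in> borel_measurable M" "h \<in> borel_measurable M"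
  shows "(\<lambda>x. boxvol m (f x) (g x) (h x)) \<in> borel_measurable M"
  unfolding boxvol_def by measurable

lemma boxvol_Suc_antiderivative:
  assumes "m \<ge> 1"
  obtains F where "\<And>y. (F has_real_derivative boxvol m a b (s - y)) (at y)"
    "F b - F a = boxvol (Suc m) a b s"
proof
  define p where "p = (\<lambda>y j. s - y - (real m - real j) * a - real j * b)"
  define F where "F = (\<lambda>y. - (\<Sum>j\<le>m. (-1) ^ j * real (m choose j) * max (p y j) 0 ^ Suc m) / fact (Suc m))"
  have p: "((\<lambda>y. max (p y j) 0 ^ Suc m) has_real_derivative - (real (Suc m) * max (p y j) 0 ^ m)) (at y)" for y j
  proof -
    have "((\<lambda>y. p y j) has_real_derivative -1) (at y)"
      unfolding p_def by (auto intro!: derivative_eq_intros)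
    from DERIV_chain2[OF DERIV_max_0_power[OF assms] this] show ?thesis by simp
  qed
  show "(F has_real_derivative boxvol m a b (s - y)) (at y)" for y
  proof -
    have "(F has_real_derivative
       - (\<Sum>j\<le>m. (-1) ^ j * real (m choose j) * (- (real (Suc m) * max (p y j) 0 ^ m))) / fact (Suc m)) (at y)"
      unfolding F_def by (intro DERIV_cdivide DERIV_minus DERIV_sum DERIV_cmult p)
    also have "- (\<Sum>j\<le>m. (-1) ^ j * real (m choose j) * (- (real (Suc m) * max (p y j) 0 ^ m)))
      = real (Suc m) * (\<Sum>j\<le>m. (-1) ^ j * real (m choose j) * max (p y j) 0 ^ m)"
      by (simp add: sum_distrib_left sum_negf mult_ac)
    also have "\<dots> / fact (Suc m) = boxvol m a b (s - y)"
      unfolding boxvol_def p_def by simp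
    finally show ?thesis .
  qed
  define g where "g = (\<lambda>j. max (s - (real (Suc m) - real j) * a - real j * b) 0 ^ Suc m)"
  have "p a j = s - (real (Suc m) - real j) * a - real j * b"
       "p b j = s - (real (Suc m) - real (Suc j)) * a - real (Suc j) * b" for j
    by (auto simp: p_def algebra_simps)
  then have "F b - F a = (\<Sum>j\<le>m. (-1) ^ j * real (m choose j) * (g j - g (Suc j))) / fact (Suc m)"
    unfolding F_def g_def
    by (simp add: diff_divide_distrib[symmetric] sum_subtractf[symmetric] right_diff_distrib del: fact_Suc power_Suc)
  then show "F b - F a = boxvol (Suc m) a b s"
    unfolding sum_binomial_diff[symmetric] by (simp add: boxvol_def g_def)
qed

lemma boxvol_1: "boxvol (Suc 0) a b s = max (s - a) 0 - max (s - b) 0"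
  by (simp add: boxvol_def)

lemma boxvol_nonneg:
  assumes "m \<ge> 1" "a \<le> b"
  shows "boxvol m a b s \<ge> 0"
  using assms(1)
proof (induction m arbitrary: s rule: dec_induct)
  case base then show ?case using assms(2) by (simp add: boxvol_1)
next
  case (step m)
  obtain F where F: "\<And>y. (F has_real_derivative boxvol m a b (s - y)) (at y)"
    "F b - F a = boxvol (Suc m) a b s"
    using boxvol_Suc_antiderivative[OF step.hyps(1)] by blast
  have "F a \<le> F b"
    by (rule DERIV_nonneg_imp_nondecreasing[OF assms(2)]) (use F(1) step.IH in blast)
  with F(2) show ?case by simp
qed

lemma nn_integral_boxvol:
  assumes "m \<ge> 1" "a \<le> b"
  shows "(\<integral>\<^sup>+y. ennreal (boxvol m a b (s - y)) * indicator {a..b} y \<partial>lborel) = ennreal (boxvol (Suc m) a b s)"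
proof -
  obtain F where F: "\<And>y. (F has_real_derivative boxvol m a b (s - y)) (at y)"
    "F b - F a = boxvol (Suc m) a b s"
    using boxvol_Suc_antiderivative[OF assms(1)] by blast
  show ?thesis unfolding F(2)[symmetric]
    by (rule nn_integral_FTC_Icc) (use F(1) assms boxvol_nonneg in auto)
qed

interpretation lborel_prod: product_sigma_finite "\<lambda>_::nat. lborel :: real measure"
  by standard

lemma sets_box_slice:
  "finite I \<Longrightarrow> {x \<in> (\<Pi>\<^sub>E i\<in>I. {a..b::real}). (\<Sum>i\<in>I. x i) \<le> s} \<in> sets (\<Pi>\<^sub>M i\<in>I. lborel)"
proof -
  assume I: "finite I"
  have "{x \<in> (\<Pi>\<^sub>E i\<in>I. {a..b}). (\<Sum>i\<in>I. x i) \<le> s}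
     = {x \<in> space (\<Pi>\<^sub>M i\<in>I. lborel). (\<forall>i\<in>I. x i \<in> {a..b}) \<and> (\<Sum>i\<in>I. x i) \<le> s}"
    by (auto simp: space_PiM PiE_iff)
  also have "\<dots> \<in> sets (\<Pi>\<^sub>M i\<in>I. lborel)" using I by measurable
  finally show ?thesis .
qed

text \<open>
  Fubini, one coordinate at a time. The induction starts with one coordinate, since for \<open>m = 0\<close>
  the convention \<open>0 ^ 0 = 1\<close> makes \<open>boxvol 0 a b s\<close> equal to 1 even for \<open>s < 0\<close>.
\<close>
lemma emeasure_box_slice:
  fixes I :: "nat set"
  assumes "finite I" "I \<noteq> {}" "a \<le> b"
  shows "emeasure (\<Pi>\<^sub>M i\<in>I. lborel) {x \<in> (\<Pi>\<^sub>E i\<in>I. {a..b}). (\<Sum>i\<in>I. x i) \<le> s} = ennreal (boxvol (card I) a b s)"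
  using assms(1,2)
proof (induction I arbitrary: s rule: finite_ne_induct)
  case (singleton i)
  have "emeasure (\<Pi>\<^sub>M i\<in>{i}. lborel) {x \<in> (\<Pi>\<^sub>E i\<in>{i}. {a..b}). (\<Sum>i\<in>{i}. x i) \<le> s}
    = (\<integral>\<^sup>+x. indicator {a..min b s} (x i) \<partial>(\<Pi>\<^sub>M i\<in>{i}. lborel))"
    by (subst nn_integral_indicator[symmetric], rule sets_box_slice)
       (auto intro!: nn_integral_cong simp: space_PiM PiE_iff split: split_indicator)
  also have "\<dots> = (\<integral>\<^sup>+y. indicator {a..min b s} y \<partial>lborel)"
    by (rule lborel_prod.product_nn_integral_singleton) simp
  also have "\<dots> = ennreal (boxvol 1 a b s)"
    using assms(3) by (cases s a rule: linorder_cases) (auto simp: boxvol_1 min_def max_def)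
  finally show ?case by simp
next
  case (insert i I)
  note [simp] = insert.hyps
  have card: "card I \<ge> 1" using insert.hyps by (simp add: card_gt_0_iff Suc_le_eq)
  have "emeasure (\<Pi>\<^sub>M i\<in>insert i I. lborel) {x \<in> (\<Pi>\<^sub>E i\<in>insert i I. {a..b}). (\<Sum>i\<in>insert i I. x i) \<le> s}
    = (\<integral>\<^sup>+x. indicator {x \<in> (\<Pi>\<^sub>E i\<in>insert i I. {a..b}). (\<Sum>i\<in>insert i I. x i) \<le> s} x \<partial>(\<Pi>\<^sub>M i\<in>insert i I. lborel))"
    by (rule nn_integral_indicator[symmetric], rule sets_box_slice) simp
  also have "\<dots> = (\<integral>\<^sup>+y. (\<integral>\<^sup>+x. indicator {x \<in> (\<Pi>\<^sub>E i\<in>insert i I. {a..b}). (\<Sum>i\<in>insert i I. x i) \<le> s} (x(i := y))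
        \<partial>(\<Pi>\<^sub>M i\<in>I. lborel)) \<partial>lborel)"
    by (rule lborel_prod.product_nn_integral_insert_rev)
       (use insert.hyps in \<open>auto intro!: borel_measurable_indicator sets_box_slice simp del: sum.insert\<close>)
  also have "\<dots> = (\<integral>\<^sup>+y. (\<integral>\<^sup>+x. indicator {x \<in> (\<Pi>\<^sub>E i\<in>I. {a..b}). (\<Sum>i\<in>I. x i) \<le> s - y} x
        \<partial>(\<Pi>\<^sub>M i\<in>I. lborel)) * indicator {a..b} y \<partial>lborel)"
  proof (intro nn_integral_cong)
    fix y :: real
    have "(\<integral>\<^sup>+x. indicator {x \<in> (\<Pi>\<^sub>E i\<in>insert i I. {a..b}). (\<Sum>i\<in>insert i I. x i) \<le> s} (x(i := y))
        \<partial>(\<Pi>\<^sub>M i\<in>I. lborel)) = (\<integral>\<^sup>+x. indicator {x \<in> (\<Pi>\<^sub>E i\<in>I. {a..b}). (\<Sum>i\<in>I. x i) \<le> s - y} x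
        * indicator {a..b} y \<partial>(\<Pi>\<^sub>M i\<in>I. lborel))"
    proof (intro nn_integral_cong)
      fix x assume "x \<in> space (\<Pi>\<^sub>M i\<in>I. (lborel :: real measure))"
      then have x: "x \<in> extensional I" by (simp add: space_PiM PiE_def)
      have "(\<Sum>j\<in>I. (x(i := y)) j) = (\<Sum>j\<in>I. x j)"
        by (rule sum.cong) auto
      moreover have "(x(i := y) \<in> (\<Pi>\<^sub>E j\<in>insert i I. {a..b})) \<longleftrightarrow> x \<in> (\<Pi>\<^sub>E j\<in>I. {a..b}) \<and> y \<in> {a..b}"
        using x insert.hyps(3) by (auto simp: PiE_iff extensional_def split: if_splits)
      ultimately show "(indicator {x \<in> (\<Pi>\<^sub>E i\<in>insert i I. {a..b}). (\<Sum>i\<in>insert i I. x i) \<le> s} (x(i := y)) :: ennreal)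
        = indicator {x \<in> (\<Pi>\<^sub>E i\<in>I. {a..b}). (\<Sum>i\<in>I. x i) \<le> s - y} x * indicator {a..b} y"
        by (auto simp: algebra_simps split: split_indicator)
    qed
    also have "\<dots> = (\<integral>\<^sup>+x. indicator {x \<in> (\<Pi>\<^sub>E i\<in>I. {a..b}). (\<Sum>i\<in>I. x i) \<le> s - y} x
        \<partial>(\<Pi>\<^sub>M i\<in>I. lborel)) * indicator {a..b} y"
      by (rule nn_integral_multc) (auto intro!: borel_measurable_indicator sets_box_slice)
    finally show "(\<integral>\<^sup>+x. indicator {x \<in> (\<Pi>\<^sub>E i\<in>insert i I. {a..b}). (\<Sum>i\<in>insert i I. x i) \<le> s} (x(i := y))
        \<partial>(\<Pi>\<^sub>M i\<in>I. lborel)) = \<dots>" .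
  qed
  also have "\<dots> = (\<integral>\<^sup>+y. ennreal (boxvol (card I) a b (s - y)) * indicator {a..b} y \<partial>lborel)"
    by (subst nn_integral_indicator) (auto intro!: sets_box_slice simp: insert.IH)
  also have "\<dots> = ennreal (boxvol (card (insert i I)) a b s)"
    using nn_integral_boxvol[OF card assms(3)] by simp
  finally show ?case .
qed

section \<open>Splitting the set according to its two largest atoms\<close>

text \<open>
  Ties are allowed: any indices attaining the two largest values will do.
\<close>
lemma
  assumes "i < k" "j < k" "i \<noteq> j" and i: "\<And>l. l < k \<Longrightarrow> p l \<le> p i"
    and j: "\<And>l. l < k \<Longrightarrow> l \<noteq> i \<Longrightarrow> p l \<le> p j"
  shows sorted_atom_second: "sorted_atom k p 2 = p j"
    and sorted_atom_last: "c \<le> sorted_atom k p k \<longleftrightarrow> (\<forall>l<k. c \<le> p l)"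
proof -
  define zs where "zs = sort (map p (filter (\<lambda>l. l \<noteq> i \<and> l \<noteq> j) [0..<k]))"
  have "mset (zs @ [p j, p i]) = image_mset p (mset_set ({..<k} - {i, j}) + {#j#} + {#i#})"
    by (auto simp: zs_def filter_mset_mset_set intro!: arg_cong[where f = "image_mset p"] arg_cong[where f = mset_set])
  also have "mset_set ({..<k} - {i, j}) + {#j#} + {#i#} = mset_set (insert i (insert j ({..<k} - {i, j})))"
    using assms(1-3) by (subst mset_set.insert, simp, simp)+ simp
  also have "insert i (insert j ({..<k} - {i, j})) = {0..<k}" using assms(1-3) by auto
  finally have "mset (zs @ [p j, p i]) = mset (map p [0..<k])" by simp
  moreover have "sorted (zs @ [p j, p i])"
    using i j assms(1-3) by (auto simp: zs_def sorted_append)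
  ultimately have "sort (map p [0..<k]) = zs @ [p j, p i]"
    using properties_for_sort by metis
  then show "sorted_atom k p 2 = p j" by (simp add: sorted_atom_def)
next
  let ?ys = "sort (map p [0..<k])"
  have "sorted_atom k p k = ?ys ! 0"
    using assms(1) by (simp add: sorted_atom_def rev_nth)
  moreover have "(\<forall>l<k. c \<le> p l) \<longleftrightarrow> (\<forall>y\<in>set ?ys. c \<le> y)" by auto
  moreover have "(\<forall>y\<in>set ?ys. c \<le> y) \<longleftrightarrow> c \<le> ?ys ! 0"
  proof -
    have "?ys ! 0 \<le> ?ys ! l" if "l < k" for l
      using that by (intro sorted_nth_mono) auto
    moreover have "set ?ys = (\<lambda>l. ?ys ! l) ` {..<k}"
      by (subst set_conv_nth) auto
    ultimately show ?thesis using assms(1) by (auto intro: order_trans)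
  qed
  ultimately show "c \<le> sorted_atom k p k \<longleftrightarrow> (\<forall>l<k. c \<le> p l)" by simp
qed

text \<open>
  The inverse of the chart that drops the last coordinate.
\<close>
definition full_law :: "nat \<Rightarrow> (nat \<Rightarrow> real) \<Rightarrow> nat \<Rightarrow> real" where
  "full_law n x = x(n := 1 - (\<Sum>l<n. x l))"

abbreviation chart :: "nat \<Rightarrow> (nat \<Rightarrow> real) measure" where
  "chart n \<equiv> \<Pi>\<^sub>M i\<in>{..<n}. lborel"

lemma space_chart: "space (chart n) = extensional {..<n}"
  by (simp add: space_PiM PiE_def)

lemma full_law_measurable:
  assumes "l \<le> n"
  shows "(\<lambda>x. full_law n x l) \<in> borel_measurable (chart n)"
proof (cases "l = n")
  case True
  then show ?thesis by (simp add: full_law_def)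
next
  case False
  with assms have "l \<in> {..<n}" by simp
  then show ?thesis using False by (simp add: full_law_def)
qed

lemma chart_image:
  "(\<lambda>p. restrict p {..<n}) ` {p \<in> prob_simplex (Suc n). Q p}
   = {x \<in> space (chart n). (\<forall>l\<le>n. 0 \<le> full_law n x l) \<and> Q (full_law n x)}" (is "?L = ?R")
proof (intro set_eqI iffI)
  fix x assume "x \<in> ?L"
  then obtain p where p: "p \<in> prob_simplex (Suc n)" "Q p" "x = restrict p {..<n}" by auto
  have "(\<Sum>l<n. restrict p {..<n} l) = (\<Sum>l<n. p l)" by (rule sum.cong) auto
  moreover have "p \<in> extensional {..<Suc n}" "(\<Sum>l<Suc n. p l) = 1" and nn: "\<And>l. l \<le> n \<Longrightarrow> 0 \<le> p l"
    using p(1) by (auto simp: prob_simplex_def less_Suc_eq_le)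
  ultimately have "full_law n x = p"
    by (auto simp: p(3) full_law_def fun_eq_iff restrict_def extensional_def)
  with p nn show "x \<in> ?R" by (simp add: space_chart)
next
  fix x assume x: "x \<in> ?R"
  then have "x \<in> extensional {..<n}" by (simp add: space_chart)
  then have "full_law n x \<in> extensional {..<Suc n}" "x = restrict (full_law n x) {..<n}"
    by (auto simp: full_law_def extensional_def fun_eq_iff)
  moreover have "(\<Sum>l<Suc n. full_law n x l) = 1" by (simp add: full_law_def)
  ultimately show "x \<in> ?L" using x
    by (auto simp: prob_simplex_def less_Suc_eq_le intro!: image_eqI[where x = "full_law n x"])
qed

text \<open>
  Ties are admitted in the rankings, so that the pieces cover the whole set; they overlap only
  where two atoms coincide, which is a null set.
\<close>
definition ranked :: "nat \<Rightarrow> nat \<Rightarrow> nat \<Rightarrow> (nat \<Rightarrow> real) set" where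
  "ranked n i j = {x \<in> space (chart n).
     (\<forall>l\<le>n. 0 \<le> full_law n x l \<and> psi (Suc n) (full_law n x j) \<le> full_law n x l \<and>
       full_law n x l \<le> full_law n x i \<and> (l \<noteq> i \<longrightarrow> full_law n x l \<le> full_law n x j))}"

lemma psi_measurable:
  assumes [measurable]: "f \<in> borel_measurable M"
  shows "(\<lambda>x. psi k (f x)) \<in> borel_measurable M"
  unfolding psi_def by measurable

lemma ranked_sets:
  assumes "i \<le> n" "j \<le> n"
  shows "ranked n i j \<in> sets (chart n)"
proof -
  have meas: "{x \<in> space M. 0 \<le> f x \<and> psi k (h x) \<le> f x \<and> f x \<le> g x \<and> (b \<longrightarrow> f x \<le> h x)} \<in> sets M"
    if [measurable]: "f \<in> borel_measurable M" "g \<in> borel_measurable M" "h \<in> borel_measurable M"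
    for M :: "(nat \<Rightarrow> real) measure" and f g h k b
    by (intro sets.sets_Collect_conj sets.sets_Collect_imp sets.sets_Collect_const borel_measurable_le
          psi_measurable borel_measurable_const that)
  have one: "{x \<in> space (chart n).
     0 \<le> full_law n x l \<and> psi (Suc n) (full_law n x j) \<le> full_law n x l \<and>
       full_law n x l \<le> full_law n x i \<and> (l \<noteq> i \<longrightarrow> full_law n x l \<le> full_law n x j)} \<in> sets (chart n)"
    if "l \<le> n" for l
    by (intro meas full_law_measurable assms that)
  have "ranked n i j = {x \<in> space (chart n). \<forall>l\<in>{..n}.
     0 \<le> full_law n x l \<and> psi (Suc n) (full_law n x j) \<le> full_law n x l \<and>
       full_law n x l \<le> full_law n x i \<and> (l \<noteq> i \<longrightarrow> full_law n x l \<le> full_law n x j)}"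
    by (simp only: ranked_def Ball_def atMost_iff)
  also have "\<dots> = (\<Inter>l\<in>{..n}. {x \<in> space (chart n).
     0 \<le> full_law n x l \<and> psi (Suc n) (full_law n x j) \<le> full_law n x l \<and>
       full_law n x l \<le> full_law n x i \<and> (l \<noteq> i \<longrightarrow> full_law n x l \<le> full_law n x j)})"
    by blast
  also have "\<dots> \<in> sets (chart n)"
    using one by (intro sets.finite_INT) auto
  finally show ?thesis .
qed

lemma ex_argmax:
  fixes p :: "'a \<Rightarrow> real"
  assumes "finite A" "A \<noteq> {}"
  shows "\<exists>i\<in>A. \<forall>l\<in>A. p l \<le> p i"
proof -
  have "Max (p ` A) \<in> p ` A" using assms by (intro Max_in) auto
  then obtain i where "i \<in> A" "p i = Max (p ` A)" by auto
  then show ?thesis using Max_ge[of "p ` A"] assms by (intro bexI[of _ i]) auto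
qed

lemma B_set_image:
  assumes "n \<ge> 1"
  shows "(\<lambda>p. restrict p {..<n}) ` B_set (Suc n)
    = (\<Union>(i, j) \<in> {(i, j). i \<le> n \<and> j \<le> n \<and> i \<noteq> j}. ranked n i j)" (is "_ = ?U")
proof -
  have "(\<lambda>p. restrict p {..<n}) ` B_set (Suc n) = {x \<in> space (chart n). (\<forall>l\<le>n. 0 \<le> full_law n x l) \<and>
     psi (Suc n) (sorted_atom (Suc n) (full_law n x) 2) \<le> sorted_atom (Suc n) (full_law n x) (Suc n)}"
    unfolding B_set_def by (rule chart_image)
  also have "\<dots> = ?U"
  proof (intro set_eqI iffI)
    fix x assume x: "x \<in> {x \<in> space (chart n). (\<forall>l\<le>n. 0 \<le> full_law n x l) \<and>
     psi (Suc n) (sorted_atom (Suc n) (full_law n x) 2) \<le> sorted_atom (Suc n) (full_law n x) (Suc n)}"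
    let ?p = "full_law n x"
    obtain i where i: "i \<le> n" "\<And>l. l \<le> n \<Longrightarrow> ?p l \<le> ?p i"
      using ex_argmax[of "{..n}" ?p] by auto
    have ne: "{..n} - {i} \<noteq> {}"
    proof
      assume "{..n} - {i} = {}"
      then have "0 = i" "1 = i" using assms by auto
      then show False by simp
    qed
    obtain j where j: "j \<le> n" "j \<noteq> i" "\<And>l. l \<le> n \<Longrightarrow> l \<noteq> i \<Longrightarrow> ?p l \<le> ?p j"
      using ex_argmax[of "{..n} - {i}" ?p] ne by auto
    note s = sorted_atom_second[of i "Suc n" j ?p] sorted_atom_last[of i "Suc n" j ?p]
    have "x \<in> ranked n i j" using s x i j by (auto simp: ranked_def less_Suc_eq_le)
    with i(1) j(1,2) show "x \<in> ?U" by auto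
  next
    fix x assume "x \<in> ?U"
    then obtain i j where ij: "i \<le> n" "j \<le> n" "i \<noteq> j" and x: "x \<in> ranked n i j" by auto
    let ?p = "full_law n x"
    note s = sorted_atom_second[of i "Suc n" j ?p] sorted_atom_last[of i "Suc n" j ?p]
    show "x \<in> {x \<in> space (chart n). (\<forall>l\<le>n. 0 \<le> full_law n x l) \<and>
     psi (Suc n) (sorted_atom (Suc n) (full_law n x) 2) \<le> sorted_atom (Suc n) (full_law n x) (Suc n)}"
      using s x ij by (auto simp: ranked_def less_Suc_eq_le)
  qed
  finally show ?thesis .
qed

lemma chart_insert: "j < n \<Longrightarrow> chart n = (\<Pi>\<^sub>M i\<in>insert j ({..<n} - {j}). lborel)"
  by (rule arg_cong[where f = "\<lambda>I. PiM I (\<lambda>_. lborel)"]) auto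

lemma full_law_update:
  assumes "j < n"
  shows "full_law n (x(j := y)) l =
    (if l = j then y else if l = n then 1 - y - (\<Sum>i\<in>{..<n} - {j}. x i) else x l)"
proof -
  have "(\<Sum>i<n. (x(j := y)) i) = y + (\<Sum>i\<in>{..<n} - {j}. (x(j := y)) i)"
    using assms by (subst sum.remove[of _ j]) auto
  also have "(\<Sum>i\<in>{..<n} - {j}. (x(j := y)) i) = (\<Sum>i\<in>{..<n} - {j}. x i)"
    by (rule sum.cong) auto
  finally show ?thesis using assms by (simp add: full_law_def)
qed

text \<open>
  When all coordinates but one are fixed, two atoms coincide for at most one value of the free
  coordinate, also when one of the two is the dropped atom.
\<close>
lemma AE_full_law_neq:
  assumes "i \<le> n" "j \<le> n" "i \<noteq> j"
  shows "AE x in chart n. full_law n x i \<noteq> full_law n x j"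
proof -
  have *: "AE x in chart n. full_law n x i \<noteq> full_law n x j" if ij: "i < n" "j \<le> n" "i \<noteq> j" for i j
  proof -
    note [measurable] = full_law_measurable[OF less_imp_le[OF ij(1)]] full_law_measurable[OF ij(2)]
    define A where "A = {x \<in> space (chart n). full_law n x i = full_law n x j}"
    have A [measurable]: "A \<in> sets (chart n)" unfolding A_def by measurable
    have "emeasure (chart n) A = (\<integral>\<^sup>+x. indicator A x \<partial>chart n)" by simp
    also have "\<dots> = (\<integral>\<^sup>+x. (\<integral>\<^sup>+y. indicator A (x(i := y)) \<partial>lborel) \<partial>(\<Pi>\<^sub>M i\<in>{..<n} - {i}. lborel))"
      unfolding chart_insert[OF ij(1)]
      by (rule lborel_prod.product_nn_integral_insert) (use A in \<open>auto simp: chart_insert[OF ij(1)]\<close>)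
    also have "\<dots> = (\<integral>\<^sup>+x. 0 \<partial>(\<Pi>\<^sub>M i\<in>{..<n} - {i}. (lborel :: real measure)))"
    proof (intro nn_integral_cong)
      fix x :: "nat \<Rightarrow> real"
      define z where "z = (if j = n then (1 - (\<Sum>i\<in>{..<n} - {i}. x i)) / 2 else x j)"
      have "(indicator A (x(i := y)) :: ennreal) \<le> indicator {z} y" for y
        using ij by (auto simp: A_def full_law_update[OF ij(1)] z_def split: split_indicator if_splits)
      then have "(\<integral>\<^sup>+y. indicator A (x(i := y)) \<partial>lborel) \<le> (\<integral>\<^sup>+y. indicator {z} y \<partial>lborel)"
        by (intro nn_integral_mono)
      then show "(\<integral>\<^sup>+y. indicator A (x(i := y)) \<partial>lborel) = 0" by simp
    qed
    finally have "A \<in> null_sets (chart n)" by (simp add: null_sets_def)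
    then show ?thesis
      by (rule AE_I') (auto simp: A_def)
  qed
  consider "i < n" | "j < n" using assms by linarith
  then show ?thesis
  proof cases
    case 1 then show ?thesis using * assms by blast
  next
    case 2
    with *[of j i] assms show ?thesis by (auto elim!: eventually_mono)
  qed
qed

text \<open>
  Exchanging coordinate \<open>i\<close> with the dropped one is, in the chart, the replacement of \<open>x i\<close>
  by one minus the sum of all coordinates. With the other coordinates fixed this is a reflection
  of the line, so it preserves Lebesgue measure. Hence only the pieces whose largest atom is
  the dropped one have to be measured.
\<close>
lemma swap_measurable:
  assumes "i < n"
  shows "(\<lambda>x. x(i := full_law n x n)) \<in> measurable (chart n) (chart n)"
proof (rule measurable_fun_upd)
  show "{..<n} = {..<n} \<union> {i}" using assms by auto
qed (auto simp: full_law_measurable)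

lemma nn_integral_swap:
  assumes "i < n" and f[measurable]: "f \<in> borel_measurable (chart n)"
  shows "(\<integral>\<^sup>+x. f (x(i := full_law n x n)) \<partial>chart n) = (\<integral>\<^sup>+x. f x \<partial>chart n)"
proof -
  let ?J = "{..<n} - {i}"
  have "(\<integral>\<^sup>+x. f (x(i := full_law n x n)) \<partial>chart n)
    = (\<integral>\<^sup>+x. (\<integral>\<^sup>+y. f ((x(i := y))(i := full_law n (x(i := y)) n)) \<partial>lborel) \<partial>(\<Pi>\<^sub>M i\<in>?J. lborel))"
    unfolding chart_insert[OF assms(1)]
  proof (rule lborel_prod.product_nn_integral_insert)
    show "(\<lambda>x. f (x(i := full_law n x n))) \<in> borel_measurable (\<Pi>\<^sub>M i\<in>insert i ?J. lborel)"
      unfolding chart_insert[OF assms(1), symmetric]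
      using measurable_compose[OF swap_measurable[OF assms(1)] f] by simp
  qed auto
  also have "\<dots> = (\<integral>\<^sup>+x. (\<integral>\<^sup>+y. f (x(i := y)) \<partial>lborel) \<partial>(\<Pi>\<^sub>M i\<in>?J. lborel))"
  proof (rule nn_integral_cong)
    fix x assume x: "x \<in> space (\<Pi>\<^sub>M i\<in>?J. (lborel :: real measure))"
    have "(\<lambda>y. x(i := y)) \<in> measurable lborel (\<Pi>\<^sub>M i\<in>insert i ?J. (lborel :: real measure))"
      by (rule measurable_component_update[OF x]) simp
    from measurable_compose[OF this f[unfolded chart_insert[OF assms(1)]]]
    have "(\<lambda>y. f (x(i := y))) \<in> borel_measurable borel" by simp
    from nn_integral_real_affine[OF this, of "-1" "1 - (\<Sum>l\<in>?J. x l)"]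
    show "(\<integral>\<^sup>+y. f ((x(i := y))(i := full_law n (x(i := y)) n)) \<partial>lborel) = (\<integral>\<^sup>+y. f (x(i := y)) \<partial>lborel)"
      using assms(1) by (simp add: full_law_update algebra_simps)
  qed
  also have "\<dots> = (\<integral>\<^sup>+x. f x \<partial>chart n)"
    unfolding chart_insert[OF assms(1)]
    by (rule lborel_prod.product_nn_integral_insert[symmetric])
       (use f in \<open>auto simp: chart_insert[OF assms(1)]\<close>)
  finally show ?thesis .
qed

lemma emeasure_ranked_swap:
  assumes "i < n" "j \<le> n" "i \<noteq> j"
  shows "emeasure (chart n) (ranked n i j) = emeasure (chart n) (ranked n n (Transposition.transpose i n j))"
proof -
  have 1: "full_law n (x(i := full_law n x n)) l = full_law n x (Transposition.transpose i n l)" if "l \<le> n" for x l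
  proof -
    have "(\<Sum>l<n. x l) = x i + (\<Sum>l\<in>{..<n} - {i}. x l)" using assms by (subst sum.remove[of _ i]) auto
    then show ?thesis using assms(1) by (auto simp: full_law_update) (auto simp: full_law_def Transposition.transpose_def)
  qed
  have tr: "Transposition.transpose i n j \<le> n" using assms by (auto simp: Transposition.transpose_def)
  have bij: "(\<forall>l\<le>n. P l) \<longleftrightarrow> (\<forall>l\<le>n. P (Transposition.transpose i n l))" for P
  proof -
    have "Transposition.transpose i n l \<le> n" if "l \<le> n" for l using that assms by (auto simp: Transposition.transpose_def)
    then show ?thesis by (metis Transposition.transpose_involutory)
  qed
  have "x(i := full_law n x n) \<in> ranked n n (Transposition.transpose i n j) \<longleftrightarrow> x \<in> ranked n i j"
    if "x \<in> space (chart n)" for x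
  proof -
    have "x(i := full_law n x n) \<in> space (chart n)"
      using measurable_space[OF swap_measurable[OF assms(1)] that] .
    then show ?thesis using that tr assms
      by (simp add: ranked_def 1 bij[of "\<lambda>l. 0 \<le> full_law n x l \<and> psi (Suc n) (full_law n x j) \<le> full_law n x l \<and>
       full_law n x l \<le> full_law n x i \<and> (l \<noteq> i \<longrightarrow> full_law n x l \<le> full_law n x j)"])
        (auto simp: Transposition.transpose_def)
  qed
  then have "(\<integral>\<^sup>+x. indicator (ranked n i j) x \<partial>chart n)
     = (\<integral>\<^sup>+x. indicator (ranked n n (Transposition.transpose i n j)) (x(i := full_law n x n)) \<partial>chart n)"
    by (intro nn_integral_cong) (auto split: split_indicator)
  also have "\<dots> = (\<integral>\<^sup>+x. indicator (ranked n n (Transposition.transpose i n j)) x \<partial>chart n)"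
    by (rule nn_integral_swap[OF assms(1)]) (use tr in \<open>auto intro!: borel_measurable_indicator ranked_sets\<close>)
  finally show ?thesis using assms tr ranked_sets by simp
qed

section \<open>The exact volume\<close>

lemma psi_nonneg: "1 \<le> k \<Longrightarrow> 0 \<le> t \<Longrightarrow> t \<le> 1 \<Longrightarrow> 0 \<le> psi k t"
proof -
  assume "1 \<le> k" "0 \<le> t" "t \<le> 1"
  then have "(1 - t) ^ k \<le> (1 - t) ^ 1" by (intro power_decreasing) auto
  with \<open>1 \<le> k\<close> show ?thesis by (simp add: psi_def)
qed

lemma psi_le:
  assumes "2 \<le> k" "0 \<le> t" "t \<le> 1"
  shows "psi k t \<le> t"
proof -
  have "1 - real k * t \<le> (1 - t) ^ k"
    using Bernoulli_inequality[of "-t" k] assms by simp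
  then show ?thesis using assms by (simp add: psi_def field_simps)
qed

lemma continuous_on_psi [continuous_intros]:
  assumes [continuous_intros]: "continuous_on S f"
  shows "continuous_on S (\<lambda>x. psi k (f x))"
  unfolding psi_def divide_inverse by (intro continuous_intros)

definition slice :: "nat \<Rightarrow> real \<Rightarrow> real" where
  "slice k t = boxvol (k - 2) (psi k t) t (1 - 2 * t)"

lemma continuous_on_slice [continuous_intros]: "continuous_on S (slice k)"
  unfolding slice_def by (intro continuous_intros)

lemma slice_nonneg: "3 \<le> k \<Longrightarrow> 0 \<le> t \<Longrightarrow> t \<le> 1 \<Longrightarrow> 0 \<le> slice k t"
  unfolding slice_def by (intro boxvol_nonneg psi_le) auto

lemma slice_measurable [measurable]: "slice k \<in> borel_measurable borel"
  by (intro borel_measurable_continuous_onI continuous_on_slice)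

lemma slice_integrable: "slice k integrable_on {a..b}"
  by (intro integrable_continuous_interval continuous_on_slice)

lemma nn_integral_slice:
  assumes "3 \<le> k"
  shows "(\<integral>\<^sup>+t. ennreal (slice k t) * indicator {0..1/2} t \<partial>lborel) = ennreal (integral {0..1/2} (slice k))"
proof -
  have "((\<lambda>t. if t \<in> {0..1/2} then slice k t else 0) has_integral integral {0..1/2} (slice k)) UNIV"
    using slice_integrable by (subst has_integral_restrict_UNIV) (rule integrable_integral)
  then have "(\<integral>\<^sup>+t. ennreal (if t \<in> {0..1/2} then slice k t else 0) \<partial>lborel) = ennreal (integral {0..1/2} (slice k))"
    by (rule nn_integral_has_integral_lborel[rotated 2]) (use slice_nonneg assms in auto)
  moreover have "(\<integral>\<^sup>+t. ennreal (if t \<in> {0..1/2} then slice k t else 0) \<partial>lborel)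
    = (\<integral>\<^sup>+t. ennreal (slice k t) * indicator {0..1/2} t \<partial>lborel)"
    by (intro nn_integral_cong) (auto split: split_indicator)
  ultimately show ?thesis by simp
qed

text \<open>
  Fubini along coordinate \<open>j\<close>, the second largest atom \<open>y\<close>. The dropped atom is the largest
  precisely if the remaining coordinates sum to at most \<open>1 - 2 * y\<close>; nonnegativity then forces
  \<open>y \<le> 1/2\<close>, and all other conditions follow from \<open>0 \<le> psi k y \<le> y\<close>.
\<close>
lemma emeasure_ranked_dropped:
  assumes "n \<ge> 2" "j < n"
  shows "emeasure (chart n) (ranked n n j) = ennreal (integral {0..1/2} (slice (Suc n)))"
proof -
  let ?J = "{..<n} - {j}"
  have R [measurable]: "ranked n n j \<in> sets (chart n)" using assms by (intro ranked_sets) auto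
  have card: "card ?J = n - 1" using assms(2) by simp
  with assms(1) have "card ?J \<noteq> 0" by linarith
  then have J: "?J \<noteq> {}" by (intro notI) simp
  have "emeasure (chart n) (ranked n n j) = (\<integral>\<^sup>+x. indicator (ranked n n j) x \<partial>chart n)" by simp
  also have "\<dots> = (\<integral>\<^sup>+y. (\<integral>\<^sup>+x. indicator (ranked n n j) (x(j := y)) \<partial>(\<Pi>\<^sub>M i\<in>?J. lborel)) \<partial>lborel)"
    unfolding chart_insert[OF assms(2)]
    by (rule lborel_prod.product_nn_integral_insert_rev) (use R in \<open>auto simp: chart_insert[OF assms(2)]\<close>)
  also have "\<dots> = (\<integral>\<^sup>+y. ennreal (slice (Suc n) y) * indicator {0..1/2} y \<partial>lborel)"
  proof (intro nn_integral_cong)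
    fix y :: real
    let ?b = "psi (Suc n) y"
    let ?S = "{x \<in> (\<Pi>\<^sub>E i\<in>?J. {?b..y}). (\<Sum>i\<in>?J. x i) \<le> 1 - 2 * y}"
    have *: "x(j := y) \<in> ranked n n j \<longleftrightarrow> y \<in> {0..1/2} \<and> x \<in> ?S" if "x \<in> space (\<Pi>\<^sub>M i\<in>?J. (lborel :: real measure))" for x
    proof -
      have x: "x \<in> extensional ?J" using that by (simp add: space_PiM PiE_def)
      then have sp: "x(j := y) \<in> space (chart n)" using assms(2) by (auto simp: space_chart extensional_def)
      define r where "r = 1 - y - (\<Sum>i\<in>?J. x i)"
      define Q where "Q l \<longleftrightarrow> (let p = full_law n (x(j := y)) in
        0 \<le> p l \<and> psi (Suc n) (p j) \<le> p l \<and> p l \<le> p n \<and> (l \<noteq> n \<longrightarrow> p l \<le> p j))" for l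
      have Qj: "Q j \<longleftrightarrow> 0 \<le> y \<and> ?b \<le> y \<and> y \<le> r" and Qn: "Q n \<longleftrightarrow> 0 \<le> r \<and> ?b \<le> r"
        using assms(2) by (simp_all add: Q_def full_law_update r_def)
      have "Q l \<longleftrightarrow> 0 \<le> x l \<and> ?b \<le> x l \<and> x l \<le> r \<and> x l \<le> y" if "l \<in> ?J" for l
        using assms(2) that by (simp add: Q_def full_law_update r_def)
      then have QJ: "(\<forall>l\<in>?J. Q l) \<longleftrightarrow> (\<forall>l\<in>?J. 0 \<le> x l \<and> ?b \<le> x l \<and> x l \<le> r \<and> x l \<le> y)"
        by (intro ball_cong) auto
      have "x(j := y) \<in> ranked n n j \<longleftrightarrow> (\<forall>l\<le>n. Q l)"
        using sp by (simp only: ranked_def Q_def Let_def mem_Collect_eq simp_thms)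
      also have "\<dots> \<longleftrightarrow> (\<forall>l\<in>insert j (insert n ?J). Q l)"
      proof -
        have "insert j (insert n ?J) = {..n}" using assms(2) by auto
        then show ?thesis by (simp add: Ball_def)
      qed
      also have "\<dots> \<longleftrightarrow> Q j \<and> Q n \<and> (\<forall>l\<in>?J. Q l)" by (simp only: ball_simps)
      also have "\<dots> \<longleftrightarrow> (0 \<le> y \<and> ?b \<le> y \<and> y \<le> r) \<and> (0 \<le> r \<and> ?b \<le> r) \<and>
          (\<forall>l\<in>?J. 0 \<le> x l \<and> ?b \<le> x l \<and> x l \<le> r \<and> x l \<le> y)" (is "_ \<longleftrightarrow> ?R")
        by (simp only: Qj Qn QJ)
      also have "\<dots> \<longleftrightarrow> y \<in> {0..1/2} \<and> x \<in> ?S"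
      proof
        assume R: ?R
        then have "0 \<le> (\<Sum>i\<in>?J. x i)" by (intro sum_nonneg) auto
        with R have "y \<le> 1/2" unfolding r_def by linarith
        with R x show "y \<in> {0..1/2} \<and> x \<in> ?S" by (auto simp: PiE_iff r_def)
      next
        assume L: "y \<in> {0..1/2} \<and> x \<in> ?S"
        then have y: "0 \<le> y" "y \<le> 1/2" by simp_all
        have b: "0 \<le> ?b" by (rule psi_nonneg) (use y assms in linarith)+
        have b_le: "?b \<le> y" by (rule psi_le) (use y assms in linarith)+
        have xl: "?b \<le> x l" "x l \<le> y" if "l \<in> ?J" for l
        proof -
          have "x l \<in> {?b..y}" using L that by (simp add: PiE_iff)
          then show "?b \<le> x l" "x l \<le> y" by simp_all
        qed
        have r: "y \<le> r" using L by (simp add: r_def)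
        have "0 \<le> x l \<and> ?b \<le> x l \<and> x l \<le> r \<and> x l \<le> y" if "l \<in> ?J" for l
          using xl[OF that] b r by linarith
        moreover have "(0 \<le> y \<and> ?b \<le> y \<and> y \<le> r) \<and> (0 \<le> r \<and> ?b \<le> r)" using y b b_le r by linarith
        ultimately show ?R by blast
      qed
      finally show ?thesis .
    qed
    have "(\<integral>\<^sup>+x. indicator (ranked n n j) (x(j := y)) \<partial>(\<Pi>\<^sub>M i\<in>?J. lborel))
       = (\<integral>\<^sup>+x. indicator ?S x * indicator {0..1/2} y \<partial>(\<Pi>\<^sub>M i\<in>?J. lborel))"
      by (intro nn_integral_cong) (use * in \<open>auto split: split_indicator\<close>)
    also have "\<dots> = emeasure (\<Pi>\<^sub>M i\<in>?J. lborel) ?S * indicator {0..1/2} y"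
      by (subst nn_integral_multc) (auto intro!: borel_measurable_indicator sets_box_slice simp: sets_box_slice)
    also have "\<dots> = ennreal (slice (Suc n) y) * indicator {0..1/2} y"
    proof (cases "y \<in> {0..1/2}")
      case True
      have "emeasure (\<Pi>\<^sub>M i\<in>?J. lborel) ?S = ennreal (boxvol (card ?J) ?b y (1 - 2 * y))"
        by (rule emeasure_box_slice) (use True J assms in \<open>auto intro!: psi_le\<close>)
      moreover have "card ?J = Suc n - 2" using card by simp
      ultimately show ?thesis by (simp only: slice_def)
    qed simp
    finally show "(\<integral>\<^sup>+x. indicator (ranked n n j) (x(j := y)) \<partial>(\<Pi>\<^sub>M i\<in>?J. lborel))
       = ennreal (slice (Suc n) y) * indicator {0..1/2} y" .
  qed
  also have "\<dots> = ennreal (integral {0..1/2} (slice (Suc n)))"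
    using assms by (intro nn_integral_slice) auto
  finally show ?thesis .
qed

lemma emeasure_ranked:
  assumes "n \<ge> 2" "i \<le> n" "j \<le> n" "i \<noteq> j"
  shows "emeasure (chart n) (ranked n i j) = ennreal (integral {0..1/2} (slice (Suc n)))"
proof (cases "i = n")
  case True
  then show ?thesis using emeasure_ranked_dropped assms by simp
next
  case False
  then have "emeasure (chart n) (ranked n i j) = emeasure (chart n) (ranked n n (Transposition.transpose i n j))"
    using assms by (intro emeasure_ranked_swap) auto
  also have "\<dots> = ennreal (integral {0..1/2} (slice (Suc n)))"
    using False assms by (intro emeasure_ranked_dropped) (auto simp: Transposition.transpose_def)
  finally show ?thesis .
qed

lemma ranked_first: "x \<in> ranked n i j \<Longrightarrow> l \<le> n \<Longrightarrow> full_law n x l \<le> full_law n x i"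
  and ranked_second: "x \<in> ranked n i j \<Longrightarrow> l \<le> n \<Longrightarrow> l \<noteq> i \<Longrightarrow> full_law n x l \<le> full_law n x j"
  unfolding ranked_def by blast+

lemma ranked_AE_disjoint:
  assumes "i \<le> n" "j \<le> n" "i \<noteq> j" "i' \<le> n" "j' \<le> n" "i' \<noteq> j'" "(i, j) \<noteq> (i', j')"
  shows "AE x in chart n. x \<notin> ranked n i j \<or> x \<notin> ranked n i' j'"
proof (cases "i = i'")
  case False
  have "AE x in chart n. full_law n x i \<noteq> full_law n x i'"
    using False assms by (intro AE_full_law_neq) auto
  then show ?thesis
  proof (rule eventually_mono)
    fix x assume "full_law n x i \<noteq> full_law n x i'"
    then show "x \<notin> ranked n i j \<or> x \<notin> ranked n i' j'"
      using ranked_first[of x n i j i'] ranked_first[of x n i' j' i] assms(1,4) by linarith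
  qed
next
  case True
  with assms have "AE x in chart n. full_law n x j \<noteq> full_law n x j'"
    by (intro AE_full_law_neq) auto
  then show ?thesis
  proof (rule eventually_mono)
    fix x assume "full_law n x j \<noteq> full_law n x j'"
    then show "x \<notin> ranked n i j \<or> x \<notin> ranked n i' j'"
      using ranked_second[of x n i j j'] ranked_second[of x n i' j' j] assms True
      by linarith
  qed
qed

lemma chart_volume_B_set:
  assumes "n \<ge> 2"
  shows "chart_volume (Suc n) (B_set (Suc n)) = real (Suc n) * real n * integral {0..1/2} (slice (Suc n))"
proof -
  let ?P = "{(i, j). i \<le> n \<and> j \<le> n \<and> i \<noteq> j}"
  have P: "?P = Sigma {..n} (\<lambda>i. {..n} - {i})" by auto
  have I: "0 \<le> integral {0..1/2} (slice (Suc n))"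
    using slice_nonneg assms by (intro integral_nonneg slice_integrable) auto
  have "chart_volume (Suc n) (B_set (Suc n)) = measure (chart n) (\<Union>(i, j) \<in> ?P. ranked n i j)"
    using B_set_image[of n] assms by (simp add: chart_volume_def)
  also have "\<dots> = (\<Sum>(i, j)\<in>?P. measure (chart n) (ranked n i j))"
    unfolding case_prod_unfold
  proof (rule measure_UNION_AE)
    show "finite {x. fst x \<le> n \<and> snd x \<le> n \<and> fst x \<noteq> snd x}"
      using P by (simp add: case_prod_unfold)
    show "ranked n (fst x) (snd x) \<in> fmeasurable (chart n)" if "x \<in> {x. fst x \<le> n \<and> snd x \<le> n \<and> fst x \<noteq> snd x}" for x
      using that assms by (intro fmeasurableI ranked_sets) (auto simp: emeasure_ranked)
    show "pairwise (\<lambda>i j. AE x in chart n. x \<notin> ranked n (fst i) (snd i) \<or> x \<notin> ranked n (fst j) (snd j))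
       {x. fst x \<le> n \<and> snd x \<le> n \<and> fst x \<noteq> snd x}"
      by (intro pairwiseI ranked_AE_disjoint) (auto simp: prod_eq_iff)
  qed
  also have "\<dots> = (\<Sum>(i, j)\<in>?P. integral {0..1/2} (slice (Suc n)))"
    using I by (intro sum.cong) (auto simp: measure_def emeasure_ranked[OF assms])
  also have "\<dots> = real (card ?P) * integral {0..1/2} (slice (Suc n))"
    by (simp add: case_prod_unfold)
  also have "card ?P = Suc n * n" unfolding P by (subst card_SigmaI) auto
  finally show ?thesis by (simp only: of_nat_mult)
qed

lemma chart_volume_simplex:
  assumes "n \<ge> 1"
  shows "chart_volume (Suc n) (prob_simplex (Suc n)) = 1 / fact n"
proof -
  have "(\<lambda>p. restrict p {..<n}) ` prob_simplex (Suc n) = {x \<in> space (chart n). \<forall>l\<le>n. 0 \<le> full_law n x l}"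
    using chart_image[of n "\<lambda>_. True"] by simp
  also have "\<dots> = {x \<in> (\<Pi>\<^sub>E i\<in>{..<n}. {0..1}). (\<Sum>i\<in>{..<n}. x i) \<le> 1}"
  proof (intro set_eqI iffI)
    fix x assume x: "x \<in> {x \<in> space (chart n). \<forall>l\<le>n. 0 \<le> full_law n x l}"
    then have p: "0 \<le> full_law n x l" if "l \<le> n" for l using that by blast
    have nn: "0 \<le> x l" if "l < n" for l using p[of l] that by (simp add: full_law_def)
    have s: "(\<Sum>i<n. x i) \<le> 1" using p[of n] by (simp add: full_law_def)
    have "x l \<le> 1" if "l < n" for l
      using member_le_sum[of l "{..<n}" x] nn s that by force
    with x nn s show "x \<in> {x \<in> (\<Pi>\<^sub>E i\<in>{..<n}. {0..1}). (\<Sum>i\<in>{..<n}. x i) \<le> 1}"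
      by (auto simp: space_chart PiE_iff)
  next
    fix x assume "x \<in> {x \<in> (\<Pi>\<^sub>E i\<in>{..<n}. {0..1}). (\<Sum>i\<in>{..<n}. x i) \<le> (1::real)}"
    then show "x \<in> {x \<in> space (chart n). \<forall>l\<le>n. 0 \<le> full_law n x l}"
      by (auto simp: space_chart PiE_iff full_law_def)
  qed
  also have "measure (chart n) \<dots> = boxvol n 0 1 1"
    using emeasure_box_slice[of "{..<n}" 0 1 1] boxvol_nonneg[of n 0 1 1] assms
    by (simp add: measure_def lessThan_empty_iff)
  also have "\<dots> = (\<Sum>j\<le>n. if j = 0 then 1 else 0) / fact n"
    unfolding boxvol_def using assms
    by (intro arg_cong[where f = "\<lambda>s. s / fact n"] sum.cong) (auto simp: max_def power_0_left)
  finally show ?thesis by (simp add: chart_volume_def)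
qed

lemma vol_frac_slice:
  assumes "3 \<le> k"
  shows "vol_frac k = real k * real (k - 1) * fact (k - 1) * integral {0..1/2} (slice k)"
proof -
  from assms obtain n where n: "k = Suc n" "2 \<le> n" by (cases k) auto
  show ?thesis
    unfolding vol_frac_def n(1) using n(2) chart_volume_B_set[of n] chart_volume_simplex[of n]
    by (simp del: fact_Suc add: mult_ac)
qed

lemma vol_frac_formula:
  assumes "3 \<le> k" "N = k - 2"
  shows "vol_frac k = real k * (real k - 1)\<^sup>2 *
          integral {0..1/2} (\<lambda>t. \<Sum>j = 0..N. (-1) ^ j * real (N choose j) *
            (max (1 - (real j + 2) * t - (real N - real j) * psi k t) 0) ^ N)"
proof -
  have "(\<Sum>j = 0..N. (-1) ^ j * real (N choose j) *
            (max (1 - (real j + 2) * t - (real N - real j) * psi k t) 0) ^ N) = fact N * slice k t" for t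
    by (simp add: slice_def boxvol_def assms(2)[symmetric] atMost_atLeast0 algebra_simps)
  moreover have "fact (k - 1) = (real k - 1) * fact N"
    using assms by (simp add: fact_reduce of_nat_diff numeral_2_eq_2)
  ultimately show ?thesis using assms
    by (simp add: vol_frac_slice power2_eq_square of_nat_diff)
qed

section \<open>The saddle point\<close>

lemma one_minus_exp_neg_div_decreasing:
  fixes x y :: real
  assumes "0 < x" "x < y"
  shows "(1 - exp (- y)) / y < (1 - exp (- x)) / x"
proof (rule DERIV_neg_imp_decreasing[OF assms(2)])
  fix t assume "x \<le> t" "t \<le> y"
  with assms have t: "t > 0" by simp
  have "1 + t < exp t" using exp_minus_greater[of "- t"] t by simp
  then have "(1 + t) * exp (- t) < 1" by (simp add: exp_minus field_simps)
  then have "(exp (- t) * t - (1 - exp (- t))) / (t * t) < 0"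
    using t by (simp add: divide_less_0_iff algebra_simps)
  moreover have "((\<lambda>t. (1 - exp (- t)) / t) has_real_derivative (exp (- t) * t - (1 - exp (- t))) / (t * t)) (at t)"
    using t by (auto intro!: derivative_eq_intros)
  ultimately show "\<exists>D. ((\<lambda>t. (1 - exp (- t)) / t) has_real_derivative D) (at t) \<and> D < 0" by blast
qed

lemma div_exp_minus_one_decreasing:
  fixes x y :: real
  assumes "0 < x" "x < y"
  shows "y / (exp y - 1) < x / (exp x - 1)"
proof (rule DERIV_neg_imp_decreasing[OF assms(2)])
  fix t assume "x \<le> t" "t \<le> y"
  with assms have t: "t > 0" by simp
  then have e: "exp t - 1 > 0" by simp
  have "1 - t < exp (- t)" using exp_minus_greater[of t] t by simp
  then have "(1 - t) * exp t < 1" by (simp add: exp_minus field_simps)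
  then have "((exp t - 1) - t * exp t) / ((exp t - 1) * (exp t - 1)) < 0"
    using e by (intro divide_neg_pos mult_pos_pos) (simp_all add: algebra_simps)
  moreover have "((\<lambda>t. t / (exp t - 1)) has_real_derivative ((exp t - 1) - t * exp t) / ((exp t - 1) * (exp t - 1))) (at t)"
    using e by (auto intro!: derivative_eq_intros)
  ultimately show "\<exists>D. ((\<lambda>t. t / (exp t - 1)) has_real_derivative D) (at t) \<and> D < 0" by blast
qed

text \<open>
  The saddle equation reads \<open>saddle c = 1\<close>; both summands are decreasing, whence uniqueness.
\<close>
definition saddle :: "real \<Rightarrow> real" where
  "saddle c = (1 - exp (- c)) / c + c / (exp c - 1)"

lemma saddle_iff: "(1 - exp (- c)) / c = 1 - c / (exp c - 1) \<longleftrightarrow> saddle c = 1"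
  by (auto simp: saddle_def)

lemma saddle_decreasing: "0 < x \<Longrightarrow> x < y \<Longrightarrow> saddle y < saddle x"
  unfolding saddle_def
  by (intro add_strict_mono one_minus_exp_neg_div_decreasing div_exp_minus_one_decreasing)

section \<open>Numerical enclosures\<close>

text \<open>
  The Taylor polynomial of the exponential function in nested form, scaled by factorials as in
  \<open>exp_horner_eq\<close>. Nesting keeps the denominators of the intermediate fractions small when it is
  evaluated at decimal fractions.
\<close>
fun exp_horner :: "nat \<Rightarrow> real \<Rightarrow> real \<Rightarrow> real" where
  "exp_horner 0 k x = 0"
| "exp_horner (Suc n) k x = 1 + x / (k + 1) * exp_horner n (k + 1) x"

lemma exp_horner_numeral [simp]:
  "exp_horner (numeral n) k x = 1 + x / (k + 1) * exp_horner (pred_numeral n) (k + 1) x"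
  by (simp add: numeral_eq_Suc)

lemma exp_horner_eq: "exp_horner n (real k) x = fact k * (\<Sum>i<n. x ^ i / fact (k + i))"
proof (induction n arbitrary: k)
  case (Suc n)
  have "fact k * (\<Sum>i<Suc n. x ^ i / fact (k + i)) = 1 + fact k * (\<Sum>i<n. x ^ Suc i / fact (k + Suc i))"
    by (subst sum.lessThan_Suc_shift) (simp add: algebra_simps)
  also have "fact k * (\<Sum>i<n. x ^ Suc i / fact (k + Suc i)) = x / (real k + 1) * (fact (Suc k) * (\<Sum>i<n. x ^ i / fact (Suc k + i)))"
    unfolding sum_distrib_left
  proof (rule sum.cong)
    fix i
    have "fact k * (x ^ Suc i / F) = x / (real k + 1) * ((real k + 1) * fact k * (x ^ i / F))" for F by simp
    from this[of "fact (k + Suc i)"]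
    show "fact k * (x ^ Suc i / fact (k + Suc i)) = x / (real k + 1) * (fact (Suc k) * (x ^ i / fact (Suc k + i)))"
      by (simp add: add.commute)
  qed simp
  finally show ?case using Suc.IH[of "Suc k"] by (simp add: add.commute)
qed simp

lemma exp_taylor_bounds:
  fixes x :: real
  assumes "0 \<le> x" "x \<le> 1"
  shows "exp_horner n 0 x \<le> exp x" "exp x \<le> exp_horner n 0 x + 3 * x ^ n / fact n"
proof -
  obtain t where t: "\<bar>t\<bar> \<le> \<bar>x\<bar>" "exp x = (\<Sum>i<n. x ^ i / fact i) + exp t / fact n * x ^ n"
    using Maclaurin_exp_le by blast
  have "exp t \<le> exp 1" using t(1) assms by simp
  then have "exp t \<le> 3" using exp_le by linarith
  then have "exp t / fact n * x ^ n \<le> 3 / fact n * x ^ n"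
    using assms by (intro mult_right_mono divide_right_mono) auto
  moreover have "0 \<le> exp t / fact n * x ^ n" using assms by simp
  moreover have "exp_horner n 0 x = (\<Sum>i<n. x ^ i / fact i)" using exp_horner_eq[of n 0 x] by simp
  ultimately show "exp_horner n 0 x \<le> exp x" "exp x \<le> exp_horner n 0 x + 3 * x ^ n / fact n"
    using t(2) by auto
qed

text \<open>
  Arguments with many digits are split into a short decimal and a remainder below 1/10000, for
  which four Taylor terms suffice.
\<close>
lemma exp_07: "2.0137527074704765216 \<le> exp (0.7::real)" "exp (0.7::real) \<le> 2.0137527074704765217"
  using exp_taylor_bounds[of "0.7" "22"] by (simp_all add: fact_numeral power_divide)

lemma exp_075: "2.11700001661267466854 \<le> exp (0.75::real)" "exp (0.75::real) \<le> 2.11700001661267466855"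
  using exp_taylor_bounds[of "0.75" "23"] by (simp_all add: fact_numeral power_divide)

lemma exp_14: "4.0551999668446745868 \<le> exp (1.4::real)" "exp (1.4::real) \<le> 4.0551999668446745877"
proof -
  have "exp (1.4::real) = exp 0.7 * exp 0.7" by (simp flip: exp_add)
  moreover have "2.0137527074704765216 * 2.0137527074704765216 \<le> exp (0.7::real) * exp 0.7"
    "exp (0.7::real) * exp 0.7 \<le> 2.0137527074704765217 * 2.0137527074704765217"
    using exp_07 by (intro mult_mono; simp)+
  ultimately show "4.0551999668446745868 \<le> exp (1.4::real)" "exp (1.4::real) \<le> 4.0551999668446745877" by simp_all
qed

lemma exp_15: "4.4816890703380648225 \<le> exp (1.5::real)" "exp (1.5::real) \<le> 4.4816890703380648227"
proof -
  have "exp (1.5::real) = exp 0.75 * exp 0.75" by (simp flip: exp_add)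
  moreover have "2.11700001661267466854 * 2.11700001661267466854 \<le> exp (0.75::real) * exp 0.75"
    "exp (0.75::real) * exp 0.75 \<le> 2.11700001661267466855 * 2.11700001661267466855"
    using exp_075 by (intro mult_mono; simp)+
  ultimately show "4.4816890703380648225 \<le> exp (1.5::real)" "exp (1.5::real) \<le> 4.4816890703380648227" by simp_all
qed

lemma exp_neg_base: "0.2484285499850049225 \<le> exp (- 1.3926::real)" "exp (- 1.3926::real) \<le> 0.2484285499850049227"
proof -
  have d: "1.00742744766246254552 \<le> exp (0.0074::real)" "exp (0.0074::real) \<le> 1.00742744766246254553"
    using exp_taylor_bounds[of "0.0074" "9"] by (simp_all add: fact_numeral power_divide)
  have "exp (- 1.3926::real) = exp 0.0074 / exp 1.4" by (simp flip: exp_diff)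
  moreover have "1.00742744766246254552 / 4.0551999668446745877 \<le> exp (0.0074::real) / exp 1.4"
    "exp (0.0074::real) / exp 1.4 \<le> 1.00742744766246254553 / 4.0551999668446745868"
    using d exp_14 by (intro frac_le; simp)+
  ultimately show "0.2484285499850049225 \<le> exp (- 1.3926::real)"
    "exp (- 1.3926::real) \<le> 0.2484285499850049227" by simp_all
qed

lemma exp_neg_lower_end:
  "0.2484249899122517645 \<le> exp (- 1.3926143304715267::real)" "exp (- 1.3926143304715267::real) \<le> 0.2484249899122517648"
proof -
  have d: "1.00001433057420839757 \<le> exp (0.0000143304715267::real)" "exp (0.0000143304715267::real) \<le> 1.00001433057420839759"
    using exp_taylor_bounds[of "0.0000143304715267" "4"] by (simp_all add: fact_numeral power_divide)
  have "exp (- 1.3926143304715267::real) = exp (- 1.3926) / exp 0.0000143304715267" by (simp flip: exp_diff)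
  moreover have "0.2484285499850049225 / 1.00001433057420839759 \<le> exp (- 1.3926::real) / exp 0.0000143304715267"
    "exp (- 1.3926::real) / exp 0.0000143304715267 \<le> 0.2484285499850049227 / 1.00001433057420839757"
    using d exp_neg_base by (intro frac_le; simp)+
  ultimately show "0.2484249899122517645 \<le> exp (- 1.3926143304715267::real)"
    "exp (- 1.3926143304715267::real) \<le> 0.2484249899122517648" by simp_all
qed

lemma exp_neg_upper_end:
  "0.2484249899122517148 \<le> exp (- 1.3926143304715269::real)" "exp (- 1.3926143304715269::real) \<le> 0.2484249899122517151"
proof -
  have d: "1.00001433057420859757 \<le> exp (0.0000143304715269::real)" "exp (0.0000143304715269::real) \<le> 1.00001433057420859759"
    using exp_taylor_bounds[of "0.0000143304715269" "4"] by (simp_all add: fact_numeral power_divide)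
  have "exp (- 1.3926143304715269::real) = exp (- 1.3926) / exp 0.0000143304715269" by (simp flip: exp_diff)
  moreover have "0.2484285499850049225 / 1.00001433057420859759 \<le> exp (- 1.3926::real) / exp 0.0000143304715269"
    "exp (- 1.3926::real) / exp 0.0000143304715269 \<le> 0.2484285499850049227 / 1.00001433057420859757"
    using d exp_neg_base by (intro frac_le; simp)+
  ultimately show "0.2484249899122517148 \<le> exp (- 1.3926143304715269::real)"
    "exp (- 1.3926143304715269::real) \<le> 0.2484249899122517151" by simp_all
qed

lemma ln_ends:
  "ln (1.3926143304715267::real) \<le> 0.3311827939167975" "0.3311827939167975 \<le> ln (1.3926143304715269::real)"
proof -
  have d: "1.39263829211570832597 \<le> exp (0.3312::real)" "exp (0.3312::real) \<le> 1.39263829211570832598"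
    using exp_taylor_bounds[of "0.3312" "16"] by (simp_all add: fact_numeral power_divide)
  have e: "1.00001720623122799855 \<le> exp (0.0000172060832025::real)" "exp (0.0000172060832025::real) \<le> 1.00001720623122799858"
    using exp_taylor_bounds[of "0.0000172060832025" "4"] by (simp_all add: fact_numeral power_divide)
  have "exp (0.3311827939167975::real) = exp 0.3312 / exp 0.0000172060832025" by (simp flip: exp_diff)
  moreover have "1.39263829211570832597 / 1.00001720623122799858 \<le> exp (0.3312::real) / exp 0.0000172060832025"
    "exp (0.3312::real) / exp 0.0000172060832025 \<le> 1.39263829211570832598 / 1.00001720623122799855"
    using d e by (intro frac_le; simp)+
  ultimately have b: "1.3926143304715267 \<le> exp (0.3311827939167975::real)" "exp (0.3311827939167975::real) \<le> 1.3926143304715269"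
    by simp_all
  have "ln (1.3926143304715267::real) \<le> ln (exp (0.3311827939167975::real))"
    by (rule ln_mono[OF b(1)]) simp_all
  then show "ln (1.3926143304715267::real) \<le> 0.3311827939167975" by (simp only: ln_exp)
  have "ln (exp (0.3311827939167975::real)) \<le> ln (1.3926143304715269::real)"
    by (rule ln_mono[OF b(2)]) simp_all
  then show "0.3311827939167975 \<le> ln (1.3926143304715269::real)" by (simp only: ln_exp)
qed

lemma saddle_eq:
  assumes "c > 0"
  shows "saddle c = (1 - exp (- c)) / c + c * (exp (- c) / (1 - exp (- c)))"
proof -
  have "exp (- c) / (1 - exp (- c)) = 1 / (exp c - 1)"
    using assms by (simp add: exp_minus divide_simps)
  then show ?thesis by (simp add: saddle_def)
qed

text \<open>
  The saddle point is enclosed in an interval of length 2e-16; an interval of length 1e-15 would not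
  determine the rate to fifteen decimals.
\<close>
lemma saddle_lower_end: "1 < saddle 1.3926143304715267"
proof -
  let ?c = "1.3926143304715267 :: real" and ?u = "exp (- 1.3926143304715267) :: real"
  have "(1 - 0.2484249899122517648) / ?c \<le> (1 - ?u) / ?c"
    using exp_neg_lower_end by (intro divide_right_mono) simp_all
  moreover have "0.2484249899122517645 / (1 - 0.2484249899122517645) \<le> ?u / (1 - ?u)"
    using exp_neg_lower_end by (intro frac_le) simp_all
  then have "?c * (0.2484249899122517645 / (1 - 0.2484249899122517645)) \<le> ?c * (?u / (1 - ?u))"
    by (intro mult_left_mono) simp_all
  moreover have "saddle ?c = (1 - ?u) / ?c + ?c * (?u / (1 - ?u))"
    by (rule saddle_eq) simp
  ultimately have "(1 - 0.2484249899122517648) / ?c + ?c * (0.2484249899122517645 / (1 - 0.2484249899122517645)) \<le> saddle ?c"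
    by linarith
  moreover have "1 < (1 - 0.2484249899122517648) / ?c + ?c * (0.2484249899122517645 / (1 - 0.2484249899122517645))"
    by simp
  ultimately show ?thesis by linarith
qed

lemma saddle_upper_end: "saddle 1.3926143304715269 < 1"
proof -
  let ?c = "1.3926143304715269 :: real" and ?u = "exp (- 1.3926143304715269) :: real"
  have "(1 - ?u) / ?c \<le> (1 - 0.2484249899122517148) / ?c"
    using exp_neg_upper_end by (intro divide_right_mono) simp_all
  moreover have "?u / (1 - ?u) \<le> 0.2484249899122517151 / (1 - 0.2484249899122517151)"
    using exp_neg_upper_end by (intro frac_le) simp_all
  then have "?c * (?u / (1 - ?u)) \<le> ?c * (0.2484249899122517151 / (1 - 0.2484249899122517151))"
    by (intro mult_left_mono) simp_all
  moreover have "saddle ?c = (1 - ?u) / ?c + ?c * (?u / (1 - ?u))"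
    by (rule saddle_eq) simp
  ultimately have "saddle ?c \<le> (1 - 0.2484249899122517148) / ?c + ?c * (0.2484249899122517151 / (1 - 0.2484249899122517151))"
    by linarith
  moreover have "(1 - 0.2484249899122517148) / ?c + ?c * (0.2484249899122517151 / (1 - 0.2484249899122517151)) < 1"
    by simp
  ultimately show ?thesis by linarith
qed

lemma saddle_point_unique: "0 < x \<Longrightarrow> 0 < y \<Longrightarrow> saddle x = saddle y \<Longrightarrow> x = y"
  by (metis less_irrefl linorder_less_linear saddle_decreasing)

lemma saddle_point_exists:
  "\<exists>c. 1.3926143304715267 < c \<and> c < 1.3926143304715269 \<and> saddle c = 1"
proof -
  have "continuous_on {1.3926143304715267..1.3926143304715269} saddle"
    unfolding saddle_def by (intro continuous_intros) auto
  then obtain c where c: "1.3926143304715267 \<le> c" "c \<le> 1.3926143304715269" "saddle c = 1"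
    using IVT2'[of saddle "1.3926143304715269" 1 "1.3926143304715267"] saddle_lower_end saddle_upper_end by auto
  have "c \<noteq> 1.3926143304715267" "c \<noteq> 1.3926143304715269"
    using c(3) saddle_lower_end saddle_upper_end by (intro notI; simp only: less_irrefl)+
  with c show ?thesis by (intro exI[of _ c]) (simp only: order_less_le simp_thms not_sym)
qed

lemma saddle_point_bounds:
  assumes "c > 0" "saddle c = 1"
  shows "1.3926143304715267 < c" "c < 1.3926143304715269"
proof -
  obtain c' where c': "1.3926143304715267 < c'" "c' < 1.3926143304715269" "saddle c' = 1"
    using saddle_point_exists by blast
  from c'(1) have "c' > 0" by (rule less_trans[rotated]) simp
  then have "c = c'" using saddle_point_unique assms c'(3) by simp
  with c' show "1.3926143304715267 < c" "c < 1.3926143304715269" by simp_all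
qed

lemma saddle_point_ex1: "\<exists>!c::real. c > 0 \<and> saddle c = 1"
proof -
  obtain c where c: "1.3926143304715267 < c" "saddle c = 1"
    using saddle_point_exists by blast
  from c(1) have "c > 0" by (rule less_trans[rotated]) simp
  with c show ?thesis using saddle_point_unique by metis
qed

definition rate :: "real \<Rightarrow> real" where
  "rate c = ln c - c - 1 + (1 - exp (- c)) / c"

text \<open>
  For \<open>c \<ge> 1\<close> the function \<open>ln c - c\<close> is decreasing, so the enclosure of the saddle
  point turns directly into one of the rate.
\<close>
lemma rate_decreasing:
  assumes "1 \<le> x" "x < y"
  shows "rate y < rate x"
proof -
  have "ln (y / x) \<le> y / x - 1" by (rule ln_le_minus_one) (use assms in simp)
  moreover have "y / x - 1 \<le> y - x"
  proof -
    have "(y - x) / x \<le> (y - x) / 1" using assms by (intro divide_left_mono) auto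
    then show ?thesis using assms by (simp add: diff_divide_distrib)
  qed
  moreover have "ln (y / x) = ln y - ln x" using assms by (simp add: ln_div)
  moreover have "(1 - exp (- y)) / y < (1 - exp (- x)) / x"
    using assms by (intro one_minus_exp_neg_div_decreasing) auto
  ultimately show ?thesis by (simp add: rate_def)
qed

lemma rate_lower_end: "rate 1.3926143304715267 \<le> - 1.521745139795282"
proof -
  let ?c = "1.3926143304715267 :: real" and ?u = "exp (- 1.3926143304715267) :: real"
  have "(1 - ?u) / ?c \<le> (1 - 0.2484249899122517645) / ?c"
    using exp_neg_lower_end by (intro divide_right_mono) simp_all
  then have "rate ?c \<le> 0.3311827939167975 - ?c - 1 + (1 - 0.2484249899122517645) / ?c"
    unfolding rate_def using ln_ends by linarith
  also have "\<dots> \<le> - 1.521745139795282" by simp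
  finally show ?thesis .
qed

lemma rate_upper_end: "- 1.5217451397952825 \<le> rate 1.3926143304715269"
proof -
  let ?c = "1.3926143304715269 :: real" and ?u = "exp (- 1.3926143304715269) :: real"
  have "- 1.5217451397952825 \<le> 0.3311827939167975 - ?c - 1 + (1 - 0.2484249899122517151) / ?c" by simp
  moreover have "(1 - 0.2484249899122517151) / ?c \<le> (1 - ?u) / ?c"
    using exp_neg_upper_end by (intro divide_right_mono) simp_all
  ultimately show ?thesis
    unfolding rate_def using ln_ends by linarith
qed

lemma rate_bounds:
  assumes "c > 0" "saddle c = 1"
  shows "- 1.5217451397952825 < rate c" "rate c < - 1.521745139795282"
proof -
  note c = saddle_point_bounds[OF assms]
  have "rate 1.3926143304715269 < rate c" "rate c < rate 1.3926143304715267"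
    using c by (intro rate_decreasing; simp)+
  then show "- 1.5217451397952825 < rate c" "rate c < - 1.521745139795282"
    using rate_lower_end rate_upper_end by linarith+
qed

text \<open>
  The lower end is sharper than the enclosure claimed for the rate: rounding it to -1.521745139795283
  would lose the last digit of its exponential.
\<close>
lemma exp_rate_ends:
  "0.218330536985878 \<le> exp (- 1.5217451397952825::real)" "exp (- 1.521745139795282::real) \<le> 0.218330536985879"
proof -
  have d: "1.02193715733146765268 \<le> exp (0.0217::real)" "exp (0.0217::real) \<le> 1.02193715733146765269"
    using exp_taylor_bounds[of "0.0217" "11"] by (simp_all add: fact_numeral power_divide)
  have e: "1.0000451408140978881 \<le> exp (0.000045139795282::real)"
    using exp_taylor_bounds[of "0.000045139795282" "4"] by (simp_all add: fact_numeral power_divide)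
  have f: "exp (0.0000451397952825::real) \<le> 1.0000451408140983891"
    using exp_taylor_bounds[of "0.0000451397952825" "4"] by (simp_all add: fact_numeral power_divide)
  have "exp (1.5217451397952825::real) = exp 1.5 * (exp 0.0217 * exp 0.0000451397952825)" by (simp flip: exp_add)
  also have "\<dots> \<le> 4.4816890703380648227 * (1.02193715733146765269 * 1.0000451408140983891)"
    using d f exp_15 by (intro mult_mono) simp_all
  also have "\<dots> \<le> inverse 0.218330536985878" by simp
  finally have u: "exp (1.5217451397952825::real) \<le> inverse 0.218330536985878" .
  have "inverse 0.218330536985879 \<le> (4.4816890703380648225 :: real) * (1.02193715733146765268 * 1.0000451408140978881)" by simp
  also have "\<dots> \<le> exp 1.5 * (exp 0.0217 * exp 0.000045139795282)"
    using d e exp_15 by (intro mult_mono) simp_all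
  also have "\<dots> = exp (1.521745139795282::real)" by (simp flip: exp_add)
  finally have l: "inverse 0.218330536985879 \<le> exp (1.521745139795282::real)" .
  show "0.218330536985878 \<le> exp (- 1.5217451397952825::real)"
    using le_imp_inverse_le[OF u] unfolding exp_minus by (simp only: inverse_inverse_eq exp_gt_zero)
  show "exp (- 1.521745139795282::real) \<le> 0.218330536985879"
    using le_imp_inverse_le[OF l] unfolding exp_minus inverse_inverse_eq by simp
qed

lemma exp_rate_bounds:
  assumes "c > 0" "saddle c = 1"
  shows "0.218330536985878 \<le> exp (rate c)" "exp (rate c) < 0.218330536985879"
proof -
  have "exp (- 1.5217451397952825) < exp (rate c)" "exp (rate c) < exp (- 1.521745139795282)"
    using rate_bounds[OF assms] by (simp_all only: exp_less_cancel_iff)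
  then show "0.218330536985878 \<le> exp (rate c)" "exp (rate c) < 0.218330536985879"
    using exp_rate_ends by linarith+
qed

section \<open>Exponential tilting at the saddle point\<close>

text \<open>
  The integral of \<open>exp (- l * u)\<close> over \<open>u\<close> from \<open>A\<close> to \<open>C\<close>.
\<close>
definition tilt_mass :: "real \<Rightarrow> real \<Rightarrow> real \<Rightarrow> real" where
  "tilt_mass l A C = (exp (- l * A) - exp (- l * C)) / l"

text \<open>
  The mean of the density proportional to \<open>exp (- l * u)\<close> on the interval from \<open>A\<close> to \<open>C\<close>,
  in other words minus the logarithmic derivative of \<open>tilt_mass\<close> in \<open>l\<close>.
\<close>
definition tilt_mean :: "real \<Rightarrow> real \<Rightarrow> real \<Rightarrow> real" where
  "tilt_mean l A C = A + 1 / l - (C - A) / (exp (l * (C - A)) - 1)"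

context
  fixes c a lam :: real
  assumes c: "c > 0" and saddle: "saddle c = 1"
    and a: "a = 1 - exp (- c)" and lam: "lam = c / (c - a)"
begin

lemma base_pos: "0 < a" "a < 1" "a < c" "1 < lam"
proof -
  show "0 < a" "a < 1" using c a by simp_all
  show "a < c" using exp_minus_greater[of c] c a by simp
  then show "1 < lam" using \<open>0 < a\<close> by (simp add: lam less_divide_eq_1_pos)
qed

text \<open>
  The saddle equation without fractions.
\<close>
lemma saddle_identity: "a * (c - a) = c\<^sup>2 * exp (- c)"
proof -
  have "a / c + c * (exp (- c) / a) = 1"
    using saddle saddle_eq[OF c] a by simp
  then show ?thesis using c base_pos by (simp add: field_simps power2_eq_square)
qed

lemma lam_times_exp: "lam * exp (- c) = a / c"
  using saddle_identity c base_pos by (simp add: lam field_simps power2_eq_square)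

text \<open>
  Both end points move with \<open>x\<close>, and the derivative is nonnegative exactly if
  \<open>lam * (x - (1 - exp (- x))) \<le> x\<close>, that is, if \<open>(1 - exp (- x)) / x\<close> is at least
  \<open>1 - 1 / lam = a / c\<close>. As this quotient is decreasing, the sign changes only once, at \<open>c\<close>.
\<close>
lemma tilt_mass_le:
  assumes "0 \<le> x"
  shows "tilt_mass lam (1 - exp (- x)) x \<le> tilt_mass lam a c"
proof -
  define G where "G x = tilt_mass lam (1 - exp (- x)) x" for x
  have G': "(G has_real_derivative exp (- lam * x) - exp (- x - lam * (1 - exp (- x)))) (at x)" for x
  proof -
    have "(G has_real_derivative (exp (- lam * (1 - exp (- x))) * (- lam * exp (- x)) - exp (- lam * x) * (- lam)) / lam) (at x)"
      unfolding G_def tilt_mass_def using base_pos by (auto intro!: derivative_eq_intros)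
    moreover have "exp (- x - lam * (1 - exp (- x))) = exp (- lam * (1 - exp (- x))) * exp (- x)"
      by (simp flip: exp_add)
    ultimately show ?thesis using base_pos by (simp add: diff_divide_distrib)
  qed
  have ca: "c - 1 + exp (- c) = c - a" by (simp add: a)
  have lam_c: "lam * (c - 1 + exp (- c)) = c" unfolding ca using base_pos by (simp add: lam)
  have key: "lam * (x - 1 + exp (- x)) \<le> x" if "0 \<le> x" "x \<le> c" for x
  proof (cases "x = 0 \<or> x = c")
    case True
    then show ?thesis using lam_c by auto
  next
    case False
    then have "(1 - exp (- c)) / c < (1 - exp (- x)) / x"
      using that by (intro one_minus_exp_neg_div_decreasing) auto
    then have "a / c < (1 - exp (- x)) / x" by (simp only: a)
    then have "a * x < (1 - exp (- x)) * c" using False that c by (simp add: field_simps)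
    then have "c * (x - 1 + exp (- x)) \<le> x * (c - a)" by (simp add: algebra_simps)
    then show ?thesis using base_pos by (simp add: lam field_simps)
  qed
  have key': "x \<le> lam * (x - 1 + exp (- x))" if "c \<le> x" for x
  proof (cases "x = c")
    case True
    then show ?thesis using lam_c by auto
  next
    case False
    then have "(1 - exp (- x)) / x < (1 - exp (- c)) / c"
      using that c by (intro one_minus_exp_neg_div_decreasing) auto
    then have "(1 - exp (- x)) / x < a / c" by (simp only: a)
    then have "(1 - exp (- x)) * c < a * x" using False that c by (simp add: field_simps)
    then have "x * (c - a) \<le> c * (x - 1 + exp (- x))" by (simp add: algebra_simps)
    then show ?thesis using base_pos by (simp add: lam field_simps)
  qed
  have "G x \<le> G c"
  proof (cases "x \<le> c")
    case True
    then show ?thesis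
    proof (rule DERIV_nonneg_imp_nondecreasing)
      fix t assume t: "x \<le> t" "t \<le> c"
      have "- t - lam * (1 - exp (- t)) \<le> - lam * t"
        using key[of t] t assms by (simp add: algebra_simps)
      then show "\<exists>y. (G has_real_derivative y) (at t) \<and> 0 \<le> y" using G'[of t] by (auto intro!: exI)
    qed
  next
    case False
    then have "c \<le> x" by simp
    then show ?thesis
    proof (rule DERIV_nonpos_imp_nonincreasing)
      fix t assume t: "c \<le> t" "t \<le> x"
      have "- lam * t \<le> - t - lam * (1 - exp (- t))"
        using key'[of t] t by (simp add: algebra_simps)
      then show "\<exists>y. (G has_real_derivative y) (at t) \<and> y \<le> 0" using G'[of t] by (auto intro!: exI)
    qed
  qed
  then show ?thesis by (simp add: G_def a)
qed

lemma tilt_mass_saddle: "tilt_mass lam a c = exp (rate c + 1 - lam)"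
proof -
  have "lam * (c - a) = c" using base_pos by (simp add: lam)
  then have "lam * c - lam * a = c" by (simp only: right_diff_distrib)
  then have "exp (- lam * c) = exp (- lam * a) * exp (- c)" by (simp flip: exp_add)
  then have "tilt_mass lam a c = exp (- lam * a) * (a / lam)"
    by (simp add: tilt_mass_def a algebra_simps diff_divide_distrib)
  also have "a / lam = c * exp (- c)"
    using lam_times_exp base_pos c by (simp add: field_simps)
  also have "exp (- lam * a) * (c * exp (- c)) = exp (- lam * a + ln c + (- c))"
    using c by (simp only: exp_add exp_ln mult.assoc)
  also have "- lam * a + ln c + (- c) = rate c + 1 - lam"
  proof -
    have e: "exp (- c) = 1 - a" using a by simp
    have "lam * (1 - a) = a / c" using lam_times_exp unfolding e .
    then have "lam - lam * a = a / c" by (simp only: right_diff_distrib mult_1_right)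
    then show ?thesis by (simp add: rate_def e)
  qed
  finally show ?thesis .
qed

lemma tilt_mean_saddle: "tilt_mean lam a c = 1"
proof -
  have lw: "lam * (c - a) = c" using base_pos by (simp add: lam)
  have "exp c - 1 = a * exp c" by (simp add: a algebra_simps flip: exp_add)
  then have "(c - a) / (exp c - 1) = (c - a) * exp (- c) / a" by (simp add: exp_minus field_simps)
  moreover have "1 / lam = (c - a) / c" using base_pos by (simp add: lam)
  moreover have "a + (c - a) / c - (c - a) * exp (- c) / a = 1"
  proof -
    have "a * (c - a) - c * (c - a) * exp (- c) = a * exp (- c) * c"
      unfolding saddle_identity by (simp add: algebra_simps power2_eq_square)
    also have "exp (- c) = 1 - a" using a by simp
    finally have "a * (c - a) - c * (c - a) * exp (- c) = a * (1 - a) * c" using a by simp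
    then show ?thesis using c base_pos by (simp add: field_simps)
  qed
  ultimately show ?thesis by (simp add: tilt_mean_def lw)
qed

text \<open>
  Cutting off the top of the interval lowers the mean; the strict gap is what makes the tilted mass
  concentrate inside the half-space in the lower bound.
\<close>
lemma tilt_mean_less_1:
  assumes "a < C" "C < c"
  shows "tilt_mean lam a C < 1"
proof -
  have l: "lam > 0" using base_pos by simp
  have "lam * (c - a) / (exp (lam * (c - a)) - 1) < lam * (C - a) / (exp (lam * (C - a)) - 1)"
    using assms l by (intro div_exp_minus_one_decreasing) auto
  then have "lam * ((c - a) / (exp (lam * (c - a)) - 1)) < lam * ((C - a) / (exp (lam * (C - a)) - 1))"
    by simp
  then have "tilt_mean lam a C < tilt_mean lam a c"
    using l unfolding tilt_mean_def mult_less_cancel_left_pos[OF l] by linarith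
  then show ?thesis using tilt_mean_saddle by simp
qed

end

section \<open>Chernoff bounds for the cut cube\<close>

lemma nn_integral_tilt:
  assumes "l > 0" "A \<le> C"
  shows "(\<integral>\<^sup>+y. ennreal (exp (- l * y)) * indicator {A..C} y \<partial>lborel) = ennreal (tilt_mass l A C)"
proof -
  have "(\<integral>\<^sup>+y. ennreal (exp (- l * y)) * indicator {A..C} y \<partial>lborel)
    = ennreal (- exp (- l * C) / l - - exp (- l * A) / l)"
    by (rule nn_integral_FTC_Icc) (use assms in \<open>auto intro!: derivative_eq_intros\<close>)
  also have "- exp (- l * C) / l - - exp (- l * A) / l = tilt_mass l A C"
    by (simp add: tilt_mass_def diff_divide_distrib)
  finally show ?thesis .
qed

abbreviation cube :: "nat \<Rightarrow> real \<Rightarrow> real \<Rightarrow> (nat \<Rightarrow> real) set" where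
  "cube m A C \<equiv> (\<Pi>\<^sub>E i\<in>{..<m}. {A..C})"

lemma cube_sets: "cube m A C \<in> sets (chart m)"
  by (intro sets_PiM_I_finite) auto

lemma tilt_mass_nonneg: "l > 0 \<Longrightarrow> A \<le> C \<Longrightarrow> 0 \<le> tilt_mass l A C"
  by (simp add: tilt_mass_def)

lemma tilt_mass_pos: "l > 0 \<Longrightarrow> A < C \<Longrightarrow> 0 < tilt_mass l A C"
  by (simp add: tilt_mass_def)

lemma nn_integral_tilt_cube:
  assumes "l > 0" "A \<le> C"
  shows "(\<integral>\<^sup>+x. ennreal (exp (- l * (\<Sum>i<m. x i))) * indicator (cube m A C) x \<partial>chart m)
    = ennreal (tilt_mass l A C ^ m)"
proof -
  have "(\<integral>\<^sup>+x. ennreal (exp (- l * (\<Sum>i<m. x i))) * indicator (cube m A C) x \<partial>chart m)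
    = (\<integral>\<^sup>+x. (\<Prod>i<m. ennreal (exp (- l * x i)) * indicator {A..C} (x i)) \<partial>chart m)"
  proof (rule nn_integral_cong)
    fix x assume "x \<in> space (chart m)"
    then have "x \<in> cube m A C \<longleftrightarrow> (\<forall>i<m. x i \<in> {A..C})" by (auto simp: space_chart PiE_iff)
    then have "indicator (cube m A C) x = (\<Prod>i<m. indicator {A..C} (x i) :: ennreal)"
      by (auto simp: indicator_def intro!: prod_zero)
    moreover have "ennreal (exp (- l * (\<Sum>i<m. x i))) = (\<Prod>i<m. ennreal (exp (- l * x i)))"
      by (simp add: sum_distrib_left exp_sum prod_ennreal flip: sum_negf)
    ultimately show "ennreal (exp (- l * (\<Sum>i<m. x i))) * indicator (cube m A C) x
        = (\<Prod>i<m. ennreal (exp (- l * x i)) * indicator {A..C} (x i))"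
      by (simp add: prod.distrib)
  qed
  also have "\<dots> = (\<Prod>i<m. \<integral>\<^sup>+y. ennreal (exp (- l * y)) * indicator {A..C} y \<partial>lborel)"
    by (rule lborel_prod.product_nn_integral_prod) auto
  also have "\<dots> = ennreal (tilt_mass l A C ^ m)"
    using nn_integral_tilt[OF assms] assms by (simp add: ennreal_power tilt_mass_nonneg)
  finally show ?thesis .
qed

lemma boxvol_nn_integral:
  assumes "m \<ge> 1" "A \<le> C"
  shows "ennreal (boxvol m A C s) = (\<integral>\<^sup>+x. indicator {x \<in> cube m A C. (\<Sum>i<m. x i) \<le> s} x \<partial>chart m)"
  using emeasure_box_slice[of "{..<m}" A C s] sets_box_slice[of "{..<m}" A C s] assms
  by (auto simp: lessThan_empty_iff)

lemma sum_measurable: "(\<lambda>x. \<Sum>i<m. x i) \<in> borel_measurable (chart m)"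
  by measurable

lemma tilt_measurable:
  "(\<lambda>x. ennreal (b * exp (- l * (\<Sum>i<m. x i))) * indicator (cube m A C) x) \<in> borel_measurable (chart m)"
  by (intro borel_measurable_times_ennreal borel_measurable_indicator cube_sets)
     (use sum_measurable[of m] in measurable)

lemma nn_integral_tilt_cube_cmult:
  assumes "l > 0" "A \<le> C" "0 \<le> b"
  shows "(\<integral>\<^sup>+x. ennreal (b * exp (- l * (\<Sum>i<m. x i))) * indicator (cube m A C) x \<partial>chart m)
    = ennreal (b * tilt_mass l A C ^ m)"
proof -
  have "(\<integral>\<^sup>+x. ennreal (b * exp (- l * (\<Sum>i<m. x i))) * indicator (cube m A C) x \<partial>chart m)
    = (\<integral>\<^sup>+x. ennreal b * (ennreal (1 * exp (- l * (\<Sum>i<m. x i))) * indicator (cube m A C) x) \<partial>chart m)"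
    using assms(3) by (intro nn_integral_cong) (simp add: ennreal_mult mult.assoc)
  also have "\<dots> = ennreal b * ennreal (tilt_mass l A C ^ m)"
    by (subst nn_integral_cmult, rule tilt_measurable) (use nn_integral_tilt_cube[OF assms(1,2)] in simp)
  also have "\<dots> = ennreal (b * tilt_mass l A C ^ m)"
    using assms by (simp add: ennreal_mult tilt_mass_nonneg)
  finally show ?thesis .
qed

lemma boxvol_le_tilt:
  assumes "m \<ge> 1" "A \<le> C" "l > 0"
  shows "boxvol m A C s \<le> exp (l * s) * tilt_mass l A C ^ m"
proof -
  have "ennreal (boxvol m A C s)
     \<le> (\<integral>\<^sup>+x. ennreal (exp (l * s) * exp (- l * (\<Sum>i<m. x i))) * indicator (cube m A C) x \<partial>chart m)"
    unfolding boxvol_nn_integral[OF assms(1,2)]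
  proof (intro nn_integral_mono)
    fix x :: "nat \<Rightarrow> real"
    have "1 \<le> exp (l * s) * exp (- l * (\<Sum>i<m. x i))" if "(\<Sum>i<m. x i) \<le> s"
      using that assms(3) by (simp flip: exp_add right_diff_distrib)
    then show "(indicator {x \<in> cube m A C. (\<Sum>i<m. x i) \<le> s} x :: ennreal)
       \<le> ennreal (exp (l * s) * exp (- l * (\<Sum>i<m. x i))) * indicator (cube m A C) x"
      by (auto split: split_indicator)
  qed
  also have "\<dots> = ennreal (exp (l * s) * tilt_mass l A C ^ m)"
    using assms by (intro nn_integral_tilt_cube_cmult) auto
  finally show ?thesis using assms by (simp add: tilt_mass_nonneg)
qed

text \<open>
  Half of Cramer's theorem: the tilted mass of the cube is split according to whether the mean of the
  coordinates is above \<open>s\<close>, below \<open>r\<close>, or in between. Shifting the tilt by \<open>h\<close> downwards or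
  upwards bounds the first two parts; the third one is at most the volume times the largest
  value of the weight.
\<close>
lemma tilt_le_boxvol:
  assumes "m \<ge> 1" "A \<le> C" "0 < h" "h < l"
  shows "tilt_mass l A C ^ m \<le> exp (- l * (real m * r)) * boxvol m A C (real m * s)
     + exp (- h * (real m * s)) * tilt_mass (l - h) A C ^ m + exp (h * (real m * r)) * tilt_mass (l + h) A C ^ m"
proof -
  have "0 \<le> tilt_mass (l - h) A C" "0 \<le> tilt_mass (l + h) A C"
    using assms by (intro tilt_mass_nonneg; linarith)+
  then have nonneg: "0 \<le> boxvol m A C (real m * s)" "0 \<le> tilt_mass (l - h) A C ^ m" "0 \<le> tilt_mass (l + h) A C ^ m"
    using assms by (simp_all add: boxvol_nonneg)
  have plus: "ennreal e * ennreal b + ennreal y + ennreal z = ennreal (e * b + y + z)"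
    if "0 \<le> e" "0 \<le> b" "0 \<le> y" "0 \<le> z" for e b y z
    using that by (simp add: ennreal_mult ennreal_plus)
  let ?S = "\<lambda>x. \<Sum>i<m. x i :: real"
  let ?c = "indicator (cube m A C) :: _ \<Rightarrow> ennreal"
  have "ennreal (tilt_mass l A C ^ m) = (\<integral>\<^sup>+x. ennreal (exp (- l * ?S x)) * ?c x \<partial>chart m)"
    using assms by (intro nn_integral_tilt_cube[symmetric]) auto
  also have "\<dots> \<le> (\<integral>\<^sup>+x. (ennreal (exp (- l * (real m * r))) * indicator {x \<in> cube m A C. ?S x \<le> real m * s} x
       + ennreal (exp (- h * (real m * s)) * exp (- (l - h) * ?S x)) * ?c x)
       + ennreal (exp (h * (real m * r)) * exp (- (l + h) * ?S x)) * ?c x \<partial>chart m)"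
  proof (intro nn_integral_mono)
    fix x :: "nat \<Rightarrow> real"
    show "ennreal (exp (- l * ?S x)) * ?c x \<le> (ennreal (exp (- l * (real m * r))) * indicator {x \<in> cube m A C. ?S x \<le> real m * s} x
       + ennreal (exp (- h * (real m * s)) * exp (- (l - h) * ?S x)) * ?c x)
       + ennreal (exp (h * (real m * r)) * exp (- (l + h) * ?S x)) * ?c x" (is "_ \<le> (?a + ?b) + ?d")
    proof (cases "x \<in> cube m A C")
      case True
      consider "real m * s < ?S x" | "?S x < real m * r" | "?S x \<le> real m * s" "real m * r \<le> ?S x" by linarith
      then show ?thesis
      proof cases
        case 1
        then have "- l * ?S x \<le> - h * (real m * s) + - (l - h) * ?S x"
          using assms(3) by (simp add: algebra_simps)
        then have "exp (- l * ?S x) \<le> exp (- h * (real m * s)) * exp (- (l - h) * ?S x)"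
          by (simp only: exp_add[symmetric] exp_le_cancel_iff)
        then have "ennreal (exp (- l * ?S x)) * ?c x \<le> ?b"
          by (intro mult_right_mono ennreal_leI) auto
        also have "\<dots> \<le> (?a + ?b) + ?d" by (simp add: add_increasing add_increasing2)
        finally show ?thesis .
      next
        case 2
        then have "- l * ?S x \<le> h * (real m * r) + - (l + h) * ?S x"
          using assms(3) by (simp add: algebra_simps)
        then have "exp (- l * ?S x) \<le> exp (h * (real m * r)) * exp (- (l + h) * ?S x)"
          by (simp only: exp_add[symmetric] exp_le_cancel_iff)
        then have "ennreal (exp (- l * ?S x)) * ?c x \<le> ?d"
          by (intro mult_right_mono ennreal_leI) auto
        also have "\<dots> \<le> (?a + ?b) + ?d" by (simp add: add_increasing)
        finally show ?thesis .
      next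
        case 3
        then have "- l * ?S x \<le> - l * (real m * r)" using assms(3,4) by (simp add: algebra_simps)
        then have "ennreal (exp (- l * ?S x)) \<le> ennreal (exp (- l * (real m * r)))"
          by (intro ennreal_leI) (simp only: exp_le_cancel_iff)
        then have "ennreal (exp (- l * ?S x)) * ?c x \<le> ?a" using True 3 by simp
        also have "\<dots> \<le> (?a + ?b) + ?d" by (simp add: add_increasing2)
        finally show ?thesis .
      qed
    qed simp
  qed
  also have "\<dots> = (ennreal (exp (- l * (real m * r))) * ennreal (boxvol m A C (real m * s))
      + ennreal (exp (- h * (real m * s)) * tilt_mass (l - h) A C ^ m))
      + ennreal (exp (h * (real m * r)) * tilt_mass (l + h) A C ^ m)"
  proof -
    have 1: "indicator {x \<in> cube m A C. ?S x \<le> real m * s} \<in> borel_measurable (chart m)"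
      by (intro borel_measurable_indicator sets_box_slice) simp
    then have 2: "(\<lambda>x. ennreal (exp (- l * (real m * r))) * indicator {x \<in> cube m A C. ?S x \<le> real m * s} x) \<in> borel_measurable (chart m)"
      by (rule borel_measurable_times_ennreal[OF borel_measurable_const])
    have pos: "0 < l - h" "0 < l + h" using assms by simp_all
    show ?thesis
      unfolding nn_integral_add[OF borel_measurable_add[OF 2 tilt_measurable] tilt_measurable]
        nn_integral_add[OF 2 tilt_measurable] nn_integral_cmult[OF 1] boxvol_nn_integral[OF assms(1,2)]
        nn_integral_tilt_cube_cmult[OF pos(1) assms(2) exp_ge_zero] nn_integral_tilt_cube_cmult[OF pos(2) assms(2) exp_ge_zero] ..
  qed
  also have "\<dots> = ennreal (exp (- l * (real m * r)) * boxvol m A C (real m * s)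
     + exp (- h * (real m * s)) * tilt_mass (l - h) A C ^ m + exp (h * (real m * r)) * tilt_mass (l + h) A C ^ m)"
    by (rule plus) (use nonneg in \<open>auto intro!: mult_nonneg_nonneg\<close>)
  finally show ?thesis
    by (rule ennreal_le_iff[THEN iffD1, rotated])
       (use nonneg in \<open>auto intro!: add_nonneg_nonneg mult_nonneg_nonneg\<close>)
qed

lemma tilt_mass_DERIV:
  assumes "l > 0" "A < C"
  shows "((\<lambda>l. tilt_mass l A C) has_real_derivative - tilt_mean l A C * tilt_mass l A C) (at l)"
proof -
  let ?EA = "exp (- l * A)" and ?EC = "exp (- l * C)"
  have "((\<lambda>l. tilt_mass l A C) has_real_derivative
      ((- A * ?EA + C * ?EC) * l - (?EA - ?EC)) / (l * l)) (at l)"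
    unfolding tilt_mass_def using assms by (auto intro!: derivative_eq_intros simp: algebra_simps)
  moreover have "((- A * ?EA + C * ?EC) * l - (?EA - ?EC)) / (l * l) = - tilt_mean l A C * tilt_mass l A C"
  proof -
    have "0 < l * (C - A)" using assms by simp
    then have nz: "exp (l * (C - A)) - 1 \<noteq> 0" using exp_gt_one by force
    have "?EA = ?EC * exp (l * (C - A))" by (simp add: algebra_simps flip: exp_add)
    then have "?EA - ?EC = ?EC * (exp (l * (C - A)) - 1)" by (simp add: algebra_simps)
    moreover have "w / X * (E * X) = w * E" if "X \<noteq> 0" for w X E :: real using that by simp
    ultimately have q: "(C - A) / (exp (l * (C - A)) - 1) * (?EA - ?EC) = (C - A) * ?EC"
      using nz by (simp only: simp_thms)
    have "- tilt_mean l A C * tilt_mass l A C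
      = ((C - A) / (exp (l * (C - A)) - 1) * (?EA - ?EC) - (A + 1 / l) * (?EA - ?EC)) / l"
    proof -
      have "- (p - q) * (D / l) = (q * D - p * D) / l" for p q D by (simp add: left_diff_distrib diff_divide_distrib)
      then show ?thesis unfolding tilt_mean_def tilt_mass_def .
    qed
    also have "\<dots> = ((C - A) * ?EC - (A + 1 / l) * (?EA - ?EC)) / l" by (simp only: q)
    also have "\<dots> = ((- A * ?EA + C * ?EC) * l - (?EA - ?EC)) / (l * l)"
      using assms by (simp add: divide_simps) (simp add: algebra_simps)
    finally show ?thesis by simp
  qed
  ultimately show ?thesis by simp
qed

text \<open>
  The two tails decay exponentially relative to the tilted mass, because the relevant ratio of
  masses equals 1 at shift 0 and, by the position of the mean between \<open>r\<close> and \<open>s\<close>, has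
  negative derivative there.
\<close>
lemma boxvol_lower:
  assumes "0 < l" "A < C" "r < tilt_mean l A C" "tilt_mean l A C < s"
  shows "\<forall>\<^sub>F m in sequentially. (exp (l * r) * tilt_mass l A C) ^ m / 2 \<le> boxvol m A C (real m * s)"
proof -
  let ?Z = "\<lambda>l. tilt_mass l A C"
  have Z: "?Z l > 0" using assms by (intro tilt_mass_pos)
  have D: "((\<lambda>h. ?Z (l + h)) has_real_derivative - tilt_mean l A C * ?Z l) (at 0)"
    using tilt_mass_DERIV[OF assms(1,2)] DERIV_shift[of ?Z "- tilt_mean l A C * ?Z l" 0 l] by (simp add: add.commute)
  have D': "((\<lambda>h. ?Z (l - h)) has_real_derivative tilt_mean l A C * ?Z l) (at 0)"
  proof -
    have "((\<lambda>h. l - h) has_real_derivative - 1) (at 0)" by (auto intro!: derivative_eq_intros)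
    moreover have "(?Z has_real_derivative - tilt_mean l A C * ?Z l) (at (l - 0))"
      using tilt_mass_DERIV[OF assms(1,2)] by simp
    ultimately show ?thesis using DERIV_chain2 by fastforce
  qed
  have "((\<lambda>h. exp (h * r) * ?Z (l + h)) has_real_derivative
      (r - tilt_mean l A C) * ?Z l) (at 0)"
    by (rule derivative_eq_intros D refl | simp add: algebra_simps)+
  moreover have "(r - tilt_mean l A C) * ?Z l < 0" using assms Z by (intro mult_neg_pos) auto
  ultimately obtain d1 where d1: "d1 > 0" "\<And>h. 0 < h \<Longrightarrow> h < d1 \<Longrightarrow> exp (h * r) * ?Z (l + h) < ?Z l"
    using DERIV_neg_dec_right[of "\<lambda>h. exp (h * r) * ?Z (l + h)" _ 0] by auto
  have "((\<lambda>h. exp (- h * s) * ?Z (l - h)) has_real_derivative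
      (tilt_mean l A C - s) * ?Z l) (at 0)"
    by (rule derivative_eq_intros D' refl | simp add: algebra_simps)+
  moreover have "(tilt_mean l A C - s) * ?Z l < 0" using assms Z by (intro mult_neg_pos) auto
  ultimately obtain d2 where d2: "d2 > 0" "\<And>h. 0 < h \<Longrightarrow> h < d2 \<Longrightarrow> exp (- h * s) * ?Z (l - h) < ?Z l"
    using DERIV_neg_dec_right[of "\<lambda>h. exp (- h * s) * ?Z (l - h)" _ 0] by auto
  define h where "h = min l (min d1 d2) / 2"
  have h: "0 < h" "h < l" "h < d1" "h < d2" using assms(1) d1(1) d2(1) by (auto simp: h_def min_def)
  define p where "p = exp (h * r) * ?Z (l + h) / ?Z l"
  define q where "q = exp (- h * s) * ?Z (l - h) / ?Z l"
  have pq: "0 \<le> p" "p < 1" "0 \<le> q" "q < 1"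
    using d1(2)[of h] d2(2)[of h] h Z assms by (auto simp: p_def q_def tilt_mass_nonneg)
  have "(\<lambda>m. p ^ m + q ^ m) \<longlonglongrightarrow> 0 + 0"
    using pq by (intro tendsto_add LIMSEQ_power_zero) auto
  then have "\<forall>\<^sub>F m in sequentially. p ^ m + q ^ m < 1/2"
    by (rule order_tendstoD) simp
  then show ?thesis
    using eventually_ge_at_top[of 1]
  proof eventually_elim
    case (elim m)
    have e: "exp (x * (real m * y)) = exp (x * y) ^ m" for x y :: real
      by (simp add: exp_of_nat_mult[symmetric] mult_ac)
    have "?Z l ^ m \<le> exp (- l * (real m * r)) * boxvol m A C (real m * s)
     + exp (- h * (real m * s)) * ?Z (l - h) ^ m + exp (h * (real m * r)) * ?Z (l + h) ^ m"
      by (rule tilt_le_boxvol) (use elim assms h in auto)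
    also have "exp (- h * (real m * s)) * ?Z (l - h) ^ m = q ^ m * ?Z l ^ m"
      using Z by (simp only: e q_def power_mult_distrib[symmetric]) simp
    also have "exp (h * (real m * r)) * ?Z (l + h) ^ m = p ^ m * ?Z l ^ m"
      using Z by (simp only: e p_def power_mult_distrib[symmetric]) simp
    finally have "(1 - (p ^ m + q ^ m)) * ?Z l ^ m \<le> exp (- l * (real m * r)) * boxvol m A C (real m * s)"
      by (simp add: algebra_simps)
    moreover have "1 / 2 * ?Z l ^ m \<le> (1 - (p ^ m + q ^ m)) * ?Z l ^ m"
      using elim Z by (intro mult_right_mono) auto
    ultimately have "1 / 2 * ?Z l ^ m \<le> exp (- l * (real m * r)) * boxvol m A C (real m * s)" by linarith
    then have "exp (l * (real m * r)) * (1 / 2 * ?Z l ^ m) \<le> exp (l * (real m * r)) * (exp (- l * (real m * r)) * boxvol m A C (real m * s))"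
      by (intro mult_left_mono) auto
    also have "\<dots> = boxvol m A C (real m * s)" by (simp add: mult.assoc[symmetric] flip: exp_add)
    finally show ?case by (simp add: e power_mult_distrib)
  qed
qed

lemma boxvol_mono:
  assumes "m \<ge> 1" "a \<le> A" "A \<le> C" "C \<le> b" "s \<le> s'"
  shows "boxvol m A C s \<le> boxvol m a b s'"
proof -
  have "ennreal (boxvol m A C s) \<le> ennreal (boxvol m a b s')"
    using assms unfolding boxvol_nn_integral[OF assms(1,3)] boxvol_nn_integral[OF assms(1) order_trans[OF assms(2) order_trans[OF assms(3,4)]]]

    by (intro nn_integral_mono) (auto split: split_indicator simp: PiE_iff intro: order_trans)
  moreover have "0 \<le> boxvol m a b s'" using assms by (intro boxvol_nonneg) auto
  ultimately show ?thesis by simp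
qed

lemma boxvol_scale:
  assumes "k > 0"
  shows "boxvol m (a / k) (b / k) (s / k) = boxvol m a b s / k ^ m"
proof -
  have "max (s / k - (real m - real j) * (a / k) - real j * (b / k)) 0 = max (s - (real m - real j) * a - real j * b) 0 / k" for j
    using assms by (simp add: max_def diff_divide_distrib[symmetric] zero_le_divide_iff divide_le_0_iff)
  then show ?thesis by (simp add: boxvol_def power_divide sum_divide_distrib mult.commute)
qed

lemma boxvol_cube:
  assumes "m \<ge> 1" "A \<le> C" "real m * C \<le> s"
  shows "boxvol m A C s = (C - A) ^ m"
proof -
  have "(\<Sum>i<m. x i) \<le> s" if "x \<in> cube m A C" for x
  proof -
    have "(\<Sum>i<m. x i) \<le> (\<Sum>i<m. C)" using that by (intro sum_mono) (auto simp: PiE_iff)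
    with assms(3) show ?thesis by simp
  qed
  then have "{x \<in> cube m A C. (\<Sum>i<m. x i) \<le> s} = cube m A C" by auto
  then have "ennreal (boxvol m A C s) = emeasure (chart m) (cube m A C)"
    using emeasure_box_slice[of "{..<m}" A C s] assms by (auto simp: lessThan_empty_iff)
  also have "\<dots> = (\<Prod>i<m. emeasure lborel {A..C})"
    by (rule lborel_prod.emeasure_PiM) auto
  also have "\<dots> = ennreal ((C - A) ^ m)" using assms by (simp add: ennreal_power)
  finally show ?thesis using assms boxvol_nonneg[of m A C s] by simp
qed

section \<open>Exponential growth rate of the volume fraction\<close>

text \<open>
  Stirling's formula up to polynomial factors, from
  \<open>(1 + 1 / n) ^ n \<le> exp 1 \<le> (1 + 1 / n) ^ (n + 1)\<close>.
\<close>
lemma fact_bounds: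
  shows "real n ^ n \<le> fact n * exp (real n)"
    and "1 \<le> n \<Longrightarrow> fact n * exp (real n) \<le> exp 1 * real n * real n ^ n"
proof -
  have up: "real (Suc n) ^ n \<le> exp 1 * real n ^ n" for n
  proof (cases "n = 0")
    case False
    have "(1 + 1 / real n) ^ n \<le> exp (1 / real n) ^ n"
      by (intro power_mono exp_ge_add_one_self) simp
    also have "\<dots> = exp 1" using False by (simp flip: exp_of_nat_mult)
    finally have "(1 + 1 / real n) ^ n * real n ^ n \<le> exp 1 * real n ^ n"
      by (intro mult_right_mono) auto
    then show ?thesis using False by (simp add: power_mult_distrib[symmetric] algebra_simps)
  qed simp
  have low: "exp 1 * real n ^ Suc n \<le> real (Suc n) ^ Suc n" for n
  proof -
    have "(real n / real (Suc n)) ^ Suc n \<le> exp (- 1 / real (Suc n)) ^ Suc n"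
    proof (rule power_mono)
      have "real n / real (Suc n) = 1 + (- 1 / real (Suc n))" by (simp add: field_simps)
      then show "real n / real (Suc n) \<le> exp (- 1 / real (Suc n))"
        using exp_ge_add_one_self[of "- 1 / real (Suc n)"] by simp
    qed simp
    also have "\<dots> = exp (real (Suc n) * (- 1 / real (Suc n)))" by (rule exp_of_nat_mult[symmetric])
    also have "real (Suc n) * (- 1 / real (Suc n)) = - 1" by simp
    finally have "real n ^ Suc n / real (Suc n) ^ Suc n \<le> exp (- 1)" by (simp only: power_divide)
    then have "real n ^ Suc n \<le> exp (- 1) * real (Suc n) ^ Suc n"
      by (simp add: divide_le_eq del: power_Suc)
    then have "exp 1 * real n ^ Suc n \<le> exp 1 * (exp (- 1) * real (Suc n) ^ Suc n)"
      by (intro mult_left_mono) simp_all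
    also have "\<dots> = real (Suc n) ^ Suc n" by (simp add: mult.assoc[symmetric] flip: exp_add del: power_Suc)
    finally show ?thesis .
  qed
  show "real n ^ n \<le> fact n * exp (real n)"
  proof (induction n)
    case (Suc n)
    have "real (Suc n) ^ Suc n \<le> real (Suc n) * (exp 1 * real n ^ n)"
      using up[of n] by (simp only: power_Suc mult_left_mono of_nat_0_le_iff)
    also have "\<dots> \<le> real (Suc n) * (exp 1 * (fact n * exp (real n)))"
      using Suc by (intro mult_left_mono) auto
    also have "\<dots> = fact (Suc n) * exp (real (Suc n))" by (simp add: exp_add algebra_simps)
    finally show ?case .
  qed simp
  show "fact n * exp (real n) \<le> exp 1 * real n * real n ^ n" if "1 \<le> n"
    using that
  proof (induction n rule: dec_induct)
    case (step n)
    have "fact (Suc n) * exp (real (Suc n)) = real (Suc n) * exp 1 * (fact n * exp (real n))"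
      by (simp add: exp_add algebra_simps)
    also have "\<dots> \<le> real (Suc n) * exp 1 * (exp 1 * real n * real n ^ n)"
      using step by (intro mult_left_mono) auto
    also have "\<dots> = exp 1 * real (Suc n) * (exp 1 * real n ^ Suc n)" by (simp add: algebra_simps)
    also have "\<dots> \<le> exp 1 * real (Suc n) * real (Suc n) ^ Suc n"
      using low[of n] by (intro mult_left_mono) auto
    finally show ?case .
  qed simp
qed

lemma power_split: "2 \<le> k \<Longrightarrow> x ^ k = x ^ (k - 2) * x\<^sup>2" for x :: real
  by (metis le_add_diff_inverse2 power_add)

lemma vol_frac_bounds:
  assumes "3 \<le> k" and I: "I = integral {0..1/2} (slice k)"
  shows "fact k * I \<le> vol_frac k" "vol_frac k \<le> real k * fact k * I"
proof -
  have I0: "0 \<le> I" unfolding I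
    using slice_nonneg assms(1) by (intro integral_nonneg slice_integrable) auto
  have f: "fact k = real k * fact (k - 1)" using assms(1) by (simp add: fact_reduce)
  have v: "vol_frac k = real (k - 1) * (fact k * I)"
    using vol_frac_slice[OF assms(1)] by (simp add: f I)
  have "0 \<le> fact k * I" using I0 by simp
  then show "fact k * I \<le> vol_frac k" "vol_frac k \<le> real k * fact k * I"
    using assms(1) mult_right_mono[of 1 "real (k - 1)" "fact k * I"]
      mult_right_mono[of "real (k - 1)" "real k" "fact k * I"] unfolding v by (simp_all add: mult.assoc)
qed

lemma one_minus_power_le_exp:
  assumes "0 \<le> t" "t \<le> 1"
  shows "(1 - t) ^ k \<le> exp (- (real k * t))"
proof -
  have "(1 - t) ^ k \<le> exp (- t) ^ k"
    using exp_ge_add_one_self[of "- t"] assms by (intro power_mono) auto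
  then show ?thesis by (simp flip: exp_of_nat_mult)
qed

lemma psi_lower:
  assumes "2 \<le> k" "0 \<le> t" "t \<le> 1"
  shows "1 - t - exp (- (real k * t)) \<le> real k * psi k t"
proof -
  have "(1 - t) ^ k \<le> (1 - t) ^ 1" using assms by (intro power_decreasing) auto
  then have n: "0 \<le> 1 - t - (1 - t) ^ k" by simp
  have "1 \<le> real k / (real k - 1)" using assms by (simp add: le_divide_eq_1)
  from mult_right_mono[OF this n] have "1 - t - (1 - t) ^ k \<le> real k * psi k t"
    by (simp add: psi_def)
  with one_minus_power_le_exp[OF assms(2,3), of k] show ?thesis by linarith
qed

lemma slice_pos:
  assumes "3 \<le> k"
  shows "0 < slice k (1 / real k)"
proof -
  have k: "real k > 2" "0 < (1 - 1 / real k) ^ k" using assms by auto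
  have lt: "psi k (1 / real k) < 1 / real k"
  proof -
    have "psi k (1 / real k) < (1 - 1 / real k) / (real k - 1)"
      unfolding psi_def using k by (intro divide_strict_right_mono) auto
    also have "\<dots> = 1 / real k" using k by (simp add: field_simps)
    finally show ?thesis .
  qed
  have "slice k (1 / real k) = (1 / real k - psi k (1 / real k)) ^ (k - 2)"
    unfolding slice_def using assms lt by (intro boxvol_cube) (auto simp: field_simps of_nat_diff)
  then show ?thesis using lt by simp
qed

lemma vol_frac_pos:
  assumes "3 \<le> k"
  shows "0 < vol_frac k"
proof -
  let ?I = "integral {0..1/2} (slice k)"
  have "0 \<le> ?I" using slice_nonneg assms by (intro integral_nonneg slice_integrable) auto
  moreover have "?I \<noteq> 0"
  proof
    assume "?I = 0"
    then have "\<forall>t\<in>{0..1/2}. slice k t = 0"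
      using integral_eq_0_iff[of 0 "1/2" "slice k"] slice_nonneg assms continuous_on_slice by auto
    moreover have "1 / real k \<in> {0..1/2}" using assms by (auto simp: field_simps)
    ultimately have "slice k (1 / real k) = 0" by blast
    then show False using slice_pos[OF assms] by simp
  qed
  ultimately have "0 < fact k * ?I" by simp
  then show ?thesis using vol_frac_bounds(1)[OF assms refl] by linarith
qed

context
  fixes c a lam :: real
  assumes c: "c > 0" and saddle: "saddle c = 1"
    and a: "a = 1 - exp (- c)" and lam: "lam = c / (c - a)"
begin

lemmas base = base_pos[OF c saddle a lam]

text \<open>
  The range of \<open>t\<close> extends far beyond the scale \<open>1 / k\<close>, where \<open>k * psi k t\<close> is no longer close to
  \<open>1 - exp (- k * t)\<close>. The factor \<open>exp (- 2 * lam * t)\<close>, which stems from the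
  bound \<open>1 - 2 * t\<close> on the coordinate sum, more than compensates the loss of \<open>t\<close>. Its effect on the
  subtracted term costs \<open>2 / k\<close>, because \<open>u * exp (- u) \<le> 1\<close>.
\<close>
lemma tilt_mass_slice_le:
  assumes k: "3 \<le> k" and t: "0 \<le> t" "t \<le> 1/2"
  shows "exp (- 2 * lam * t) * tilt_mass (lam * k) (psi k t) t \<le> (tilt_mass lam a c + 2 / k) / k"
proof -
  define x where "x = real k * t"
  have x: "0 \<le> x" using t by (simp add: x_def)
  have l: "0 < lam" using base by simp
  have k0: "0 < real k" using k by simp
  have 1: "exp (- 2 * lam * t) * exp (- (lam * k) * psi k t) \<le> exp (- lam * (1 - exp (- x)))"
  proof -
    have "1 - t - exp (- x) \<le> k * psi k t" using psi_lower[of k t] k t by (simp add: x_def)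
    then have "1 - exp (- x) \<le> 2 * t + k * psi k t" using t by linarith
    then have "lam * (1 - exp (- x)) \<le> lam * (2 * t + k * psi k t)" using l by (intro mult_left_mono) auto
    then show ?thesis by (simp add: algebra_simps flip: exp_add)
  qed
  have 2: "exp (- lam * x) - 2 / k \<le> exp (- 2 * lam * t) * exp (- lam * x)"
  proof -
    have "1 - 2 * lam * t \<le> exp (- 2 * lam * t)" using exp_ge_add_one_self[of "- 2 * lam * t"] by simp
    then have "(1 - 2 * lam * t) * exp (- lam * x) \<le> exp (- 2 * lam * t) * exp (- lam * x)"
      by (intro mult_right_mono) auto
    moreover have "lam * x * exp (- lam * x) \<le> 1"
    proof -
      have "lam * x \<le> exp (lam * x)" using exp_ge_add_one_self[of "lam * x"] by linarith
      then show ?thesis by (simp add: exp_minus field_simps)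
    qed
    then have "2 * (lam * x * exp (- lam * x)) / k \<le> 2 * 1 / k" using k0 by (intro divide_right_mono) auto
    then have "2 * lam * t * exp (- lam * x) \<le> 2 / k" using k0 by (simp add: x_def)
    ultimately show ?thesis by (simp add: algebra_simps)
  qed
  have "exp (- 2 * lam * t) * tilt_mass (lam * k) (psi k t) t
      = (exp (- 2 * lam * t) * exp (- (lam * k) * psi k t) - exp (- 2 * lam * t) * exp (- lam * x)) / (lam * k)"
    by (simp add: tilt_mass_def x_def algebra_simps diff_divide_distrib)
  also have "\<dots> \<le> (exp (- lam * (1 - exp (- x))) - (exp (- lam * x) - 2 / k)) / (lam * k)"
    using 1 2 l k0 by (intro divide_right_mono diff_mono) auto
  also have "\<dots> = (tilt_mass lam (1 - exp (- x)) x + (2 / k) / lam) / k"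
    using l k0 by (simp add: tilt_mass_def field_simps)
  also have "\<dots> \<le> (tilt_mass lam a c + 2 / k) / k"
  proof (intro divide_right_mono add_mono)
    show "tilt_mass lam (1 - exp (- x)) x \<le> tilt_mass lam a c"
      by (rule tilt_mass_le[OF c saddle a lam x])
    show "2 / k / lam \<le> 2 / k" using base(4) k0 by (simp add: divide_le_eq mult_le_cancel_left1)
  qed (use k0 in auto)
  finally show ?thesis .
qed

lemma slice_le:
  assumes k: "3 \<le> k" and t: "0 \<le> t" "t \<le> 1/2"
  shows "slice k t \<le> exp (lam * k) * ((tilt_mass lam a c + 2 / k) / k) ^ (k - 2)"
proof -
  have l: "0 < lam" using base by simp
  have psi: "psi k t \<le> t" using k t by (intro psi_le) auto
  have Z: "0 \<le> tilt_mass (lam * k) (psi k t) t" using l k psi by (intro tilt_mass_nonneg) auto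
  have "slice k t \<le> exp (lam * k * (1 - 2 * t)) * tilt_mass (lam * k) (psi k t) t ^ (k - 2)"
    unfolding slice_def using k l psi by (intro boxvol_le_tilt) auto
  also have "\<dots> \<le> (exp (lam * k) * exp (- 2 * lam * t) ^ (k - 2)) * tilt_mass (lam * k) (psi k t) t ^ (k - 2)"
  proof (intro mult_right_mono zero_le_power Z)
    have "real (k - 2) * (2 * lam * t) \<le> real k * (2 * lam * t)"
      using l t by (intro mult_right_mono) auto
    then have "lam * k * (1 - 2 * t) \<le> lam * k + real (k - 2) * (- 2 * lam * t)"
      by (simp add: algebra_simps)
    then have "exp (lam * k * (1 - 2 * t)) \<le> exp (lam * k + real (k - 2) * (- 2 * lam * t))"
      by (simp only: exp_le_cancel_iff)
    then show "exp (lam * k * (1 - 2 * t)) \<le> exp (lam * k) * exp (- 2 * lam * t) ^ (k - 2)"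
      by (simp only: exp_add exp_of_nat_mult)
  qed
  also have "\<dots> = exp (lam * k) * (exp (- 2 * lam * t) * tilt_mass (lam * k) (psi k t) t) ^ (k - 2)"
    by (simp only: power_mult_distrib mult.assoc)
  also have "\<dots> \<le> exp (lam * k) * ((tilt_mass lam a c + 2 / k) / k) ^ (k - 2)"
    using Z by (intro mult_left_mono power_mono tilt_mass_slice_le assms) auto
  finally show ?thesis .
qed

lemma exp_rate: "exp (lam - 1) * tilt_mass lam a c = exp (rate c)"
  unfolding tilt_mass_saddle[OF c saddle a lam] by (simp flip: exp_add)

lemma vol_frac_upper:
  "\<exists>K>0. \<forall>k\<ge>3. vol_frac k \<le> K * real k ^ 4 * exp (rate c * real k)"
proof -
  define Z where "Z = tilt_mass lam a c"
  \<comment> \<open>The factor with exp (2 / Z) absorbs the error 2 / k per coordinate; dividing by the square of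
    Z turns k - 2 coordinates into k factors.\<close>
  define K where "K = exp 1 * exp (2 / Z) / Z\<^sup>2"
  have Z: "0 < Z" unfolding Z_def using base by (intro tilt_mass_pos) auto
  have "0 < K" using Z by (simp add: K_def)
  moreover have "vol_frac k \<le> K * real k ^ 4 * exp (rate c * real k)" if k: "3 \<le> k" for k
  proof -
    have k0: "0 < real k" using k by simp
    let ?M = "exp (lam * k) * ((Z + 2 / k) / real k) ^ (k - 2)"
    have M0: "0 \<le> ?M" using Z k0 by simp
    have "integral {0..1/2} (slice k) \<le> integral {0..1/2} (\<lambda>_::real. ?M)"
      using slice_le[OF k] by (intro integral_le slice_integrable) (auto simp: Z_def)
    also have "\<dots> = ?M / 2" by simp
    finally have I: "integral {0..1/2} (slice k) \<le> ?M" using M0 by linarith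
    have "(Z + 2 / real k) ^ (k - 2) \<le> Z ^ (k - 2) * exp (2 / Z)"
    proof -
      have "(1 + 2 / (k * Z)) ^ (k - 2) \<le> exp (2 / (k * Z)) ^ (k - 2)"
        using Z k0 by (intro power_mono exp_ge_add_one_self) auto
      also have "\<dots> = exp (real (k - 2) * (2 / (k * Z)))" by (simp only: exp_of_nat_mult)
      also have "\<dots> \<le> exp (2 / Z)"
      proof -
        have "real (k - 2) * (2 / (k * Z)) \<le> real k * (2 / (k * Z))"
          using Z k0 by (intro mult_right_mono) auto
        also have "\<dots> = 2 / Z" using k0 by simp
        finally show ?thesis by simp
      qed
      finally have "Z ^ (k - 2) * (1 + 2 / (k * Z)) ^ (k - 2) \<le> Z ^ (k - 2) * exp (2 / Z)"
        using Z by (intro mult_left_mono) auto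
      moreover have "Z * (1 + 2 / (k * Z)) = Z + 2 / k" using Z k0 by (simp add: field_simps)
      ultimately show ?thesis by (simp only: power_mult_distrib[symmetric])
    qed
    then have "(Z + 2 / real k) ^ (k - 2) / real k ^ (k - 2) \<le> Z ^ (k - 2) * exp (2 / Z) / real k ^ (k - 2)"
      by (rule divide_right_mono) simp
    then have "?M \<le> exp (lam * k) * (Z ^ (k - 2) * exp (2 / Z) / real k ^ (k - 2))"
      unfolding power_divide by (rule mult_left_mono) simp
    also have "\<dots> = exp (lam * k) * exp (2 / Z) * (Z ^ k / Z\<^sup>2) * ((real k)\<^sup>2 / real k ^ k)"
    proof -
      have "Z ^ k = Z ^ (k - 2) * Z\<^sup>2" "real k ^ k = real k ^ (k - 2) * (real k)\<^sup>2"
        using k by (intro power_split; simp)+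
      then show ?thesis using Z k0 k by simp
    qed
    finally have I2: "integral {0..1/2} (slice k) \<le> exp (lam * k) * exp (2 / Z) * (Z ^ k / Z\<^sup>2) * ((real k)\<^sup>2 / real k ^ k)"
      using I by linarith
    have f: "fact k \<le> exp 1 * real k * real k ^ k * exp (- real k)"
      using fact_bounds(2)[of k] k by (simp add: exp_minus field_simps)
    have "vol_frac k \<le> real k * (fact k * integral {0..1/2} (slice k))"
      using vol_frac_bounds(2)[OF k refl] by (simp add: mult.assoc)
    also have "\<dots> \<le> real k * ((exp 1 * real k * real k ^ k * exp (- real k)) *
        (exp (lam * k) * exp (2 / Z) * (Z ^ k / Z\<^sup>2) * ((real k)\<^sup>2 / real k ^ k)))"
      using f I2 slice_nonneg k by (intro mult_left_mono mult_mono integral_nonneg slice_integrable) auto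
    also have "\<dots> = K * real k ^ 4 * ((exp (- real k) * exp (lam * k)) * Z ^ k)"
      using k0 by (simp add: K_def field_simps eval_nat_numeral)
    also have "exp (- real k) * exp (lam * k) = exp (lam - 1) ^ k"
      by (simp add: algebra_simps flip: exp_add exp_of_nat_mult)
    also have "exp (lam - 1) ^ k * Z ^ k = exp (rate c * real k)"
      by (simp only: Z_def exp_rate exp_of_nat2_mult power_mult_distrib[symmetric])
    finally show ?thesis .
  qed
  ultimately show ?thesis by blast
qed

lemma tilt_exponent_limit:
  "((\<lambda>C. ln (tilt_mass lam a C) + lam * tilt_mean lam a C) \<longlongrightarrow> rate c + 1) (at_left c)"
proof -
  have l: "lam \<noteq> 0" "exp (lam * (c - a)) - 1 \<noteq> 0" "0 < tilt_mass lam a c"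
    using base tilt_mass_pos[of lam a c] by auto
  have Z: "((\<lambda>C. tilt_mass lam a C) \<longlongrightarrow> tilt_mass lam a c) (at_left c)"
    unfolding tilt_mass_def using l by (intro tendsto_intros) auto
  moreover have "((\<lambda>C. tilt_mean lam a C) \<longlongrightarrow> tilt_mean lam a c) (at_left c)"
    unfolding tilt_mean_def using l by (intro tendsto_intros) auto
  ultimately have "((\<lambda>C. ln (tilt_mass lam a C) + lam * tilt_mean lam a C) \<longlongrightarrow>
      ln (tilt_mass lam a c) + lam * tilt_mean lam a c) (at_left c)"
    using l by (intro tendsto_intros) auto
  then show ?thesis
    by (simp add: tilt_mass_saddle[OF c saddle a lam] tilt_mean_saddle[OF c saddle a lam])
qed

text \<open>
  For \<open>t\<close> up to \<open>d / k\<close> with \<open>d < c\<close>, the lower end of the rescaled slice tends to at most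
  \<open>1 - exp (- d) < a\<close>. This allows the same lower end \<open>a\<close> for all these slices.
\<close>
lemma psi_upper_eventually:
  assumes "0 < d" "d < c"
  shows "\<forall>\<^sub>F k in sequentially. \<forall>t\<in>{0..d / real k}. real k * psi k t \<le> a"
proof -
  have "(\<lambda>k. real k / (real k - 1)) \<longlonglongrightarrow> 1"
  proof -
    have "(\<lambda>n. real (Suc n) / real n) \<longlonglongrightarrow> 1" by (rule LIMSEQ_Suc_n_over_n)
    then have "(\<lambda>n. real (Suc n) / (real (Suc n) - 1)) \<longlonglongrightarrow> 1" by simp
    then show ?thesis by (rule LIMSEQ_imp_Suc)
  qed
  moreover have "(\<lambda>k. (1 + - d / real k) ^ k) \<longlonglongrightarrow> exp (- d)"
    by (rule tendsto_exp_limit_sequentially)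
  ultimately have "(\<lambda>k. real k / (real k - 1) * (1 - (1 + - d / real k) ^ k)) \<longlonglongrightarrow> 1 * (1 - exp (- d))"
    by (intro tendsto_intros)
  moreover have "1 * (1 - exp (- d)) < a" using assms by (simp add: a)
  ultimately have "\<forall>\<^sub>F k in sequentially. real k / (real k - 1) * (1 - (1 + - d / real k) ^ k) < a"
    by (rule order_tendstoD(2))
  moreover have "\<forall>\<^sub>F k in sequentially. d \<le> real k"
    using filterlim_real_sequentially by (simp add: filterlim_at_top)
  ultimately show ?thesis
    using eventually_gt_at_top[of 1]
  proof eventually_elim
    case (elim k)
    show ?case
    proof
      fix t assume t: "t \<in> {0..d / real k}"
      have "1 - d / k \<le> 1 - t" "0 \<le> 1 - d / k" using t elim by auto
      then have "(1 - d / k) ^ k \<le> (1 - t) ^ k" by (intro power_mono)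
      then have "1 - t - (1 - t) ^ k \<le> 1 - (1 + - d / real k) ^ k" using t by simp
      then have "real k / (real k - 1) * (1 - t - (1 - t) ^ k) \<le> real k / (real k - 1) * (1 - (1 + - d / real k) ^ k)"
        using elim by (intro mult_left_mono) auto
      then show "real k * psi k t \<le> a" using elim by (simp add: psi_def)
    qed
  qed
qed

text \<open>
  All \<open>t\<close> between \<open>C / k\<close> and \<open>d / k\<close> with \<open>C < d < c\<close> have slices containing the cut cube with
  side \<open>[a / k, C / k]\<close>. The interval of such \<open>t\<close> has length of order \<open>1 / k\<close>, which costs only a
  polynomial factor, and the exponent is within \<open>e\<close> of the optimum once \<open>C\<close> is close to \<open>c\<close>.
\<close>
lemma vol_frac_lower:
  assumes "0 < e"
  obtains K where "0 < K" "\<forall>\<^sub>F k in sequentially. K * exp ((rate c - e) * real k) \<le> vol_frac k"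
proof -
  have l: "0 < lam" using base by simp
  have "\<forall>\<^sub>F C in at_left c. rate c + 1 - e / 2 < ln (tilt_mass lam a C) + lam * tilt_mean lam a C"
    by (rule order_tendstoD(1)[OF tilt_exponent_limit]) (use assms in simp)
  moreover have "\<forall>\<^sub>F C in at_left c. C \<in> {a<..<c}"
    by (rule eventually_at_leftI[of a]) (use base in auto)
  ultimately have "\<forall>\<^sub>F C in at_left c. C \<in> {a<..<c} \<and>
      rate c + 1 - e / 2 < ln (tilt_mass lam a C) + lam * tilt_mean lam a C"
    by eventually_elim simp
  then obtain C where C: "a < C" "C < c"
    "rate c + 1 - e / 2 < ln (tilt_mass lam a C) + lam * tilt_mean lam a C"
    using eventually_happens'[of "at_left c"] by (auto simp: trivial_limit_at_left_real)
  \<comment> \<open>Both halves of the loss e: one from replacing c by C, one from r lying below the mean.\<close>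
  define r where "r = tilt_mean lam a C - e / (2 * lam)"
  define s where "s = (tilt_mean lam a C + 1) / 2"
  define d where "d = (C + c) / 2"
  define b where "b = exp (lam * r) * tilt_mass lam a C"
  have mean: "tilt_mean lam a C < 1" by (rule tilt_mean_less_1[OF c saddle a lam C(1,2)])
  then have s: "tilt_mean lam a C < s" "s < 1" by (auto simp: s_def)
  have r: "r < tilt_mean lam a C" using assms l by (simp add: r_def)
  have d: "C < d" "d < c" "0 < d" using C base by (auto simp: d_def)
  have Z: "0 < tilt_mass lam a C" using C l by (intro tilt_mass_pos)
  then have b0: "0 < b" by (simp add: b_def)
  have b: "exp (rate c - e) * exp 1 \<le> b"
  proof -
    have "lam * r = lam * tilt_mean lam a C - e / 2" using l by (simp add: r_def right_diff_distrib)
    with C(3) have "rate c - e + 1 \<le> lam * r + ln (tilt_mass lam a C)" by linarith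
    then have "exp (rate c - e + 1) \<le> exp (lam * r + ln (tilt_mass lam a C))" by simp
    then show ?thesis using Z by (simp add: exp_add b_def)
  qed
  define K where "K = (d - C) / (2 * b\<^sup>2)"
  have "K > 0" using d b0 by (simp add: K_def)
  moreover have "\<forall>\<^sub>F k in sequentially. K * exp ((rate c - e) * real k) \<le> vol_frac k"
  proof -
    have 1: "\<forall>\<^sub>F k in sequentially. b ^ (k - 2) / 2 \<le> boxvol (k - 2) a C (real (k - 2) * s)"
      using boxvol_lower[OF l C(1) r s(1)] unfolding b_def[symmetric]
      by (rule eventually_compose_filterlim) (rule filterlim_minus_const_nat_at_top)
    have 2: "\<forall>\<^sub>F k in sequentially. (2 * d - 2 * s) / (1 - s) \<le> real k"
      and 3: "\<forall>\<^sub>F k in sequentially. 2 * d \<le> real k"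
      using filterlim_real_sequentially by (auto simp: filterlim_at_top)
    show ?thesis
      using 1 2 3 psi_upper_eventually[OF d(3,2)] eventually_ge_at_top[of 3]
    proof eventually_elim
      case (elim k)
      note k = elim(5)
      have k0: "0 < real k" using k by simp
      let ?m = "b ^ (k - 2) / 2 / real k ^ (k - 2)"
      have pt: "?m \<le> slice k t" if t: "t \<in> {C / real k..d / real k}" for t
      proof -
        have Cd: "C \<le> real k * t" "real k * t \<le> d" using t k0 by (auto simp: field_simps)
        have "0 \<le> t" using Cd(1) C(1) base(1) k0 by (smt (verit) mult_nonneg_nonpos)
        then have "real k * psi k t \<le> a" using elim(4) t by auto
        then have psi: "psi k t \<le> a / real k" using k0 by (simp add: field_simps)
        have "2 * d - 2 * s \<le> real k * (1 - s)" using elim(2) s by (simp add: field_simps)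
        then have "real (k - 2) * s \<le> real k * (1 - 2 * t)"
          using Cd(2) k by (simp add: of_nat_diff algebra_simps)
        then have sum: "real (k - 2) * s / real k \<le> 1 - 2 * t" using k0 by (simp add: field_simps)
        have "?m \<le> boxvol (k - 2) a C (real (k - 2) * s) / real k ^ (k - 2)"
          using elim(1) k0 by (intro divide_right_mono) auto
        also have "\<dots> = boxvol (k - 2) (a / k) (C / k) (real (k - 2) * s / k)"
          using boxvol_scale[OF k0] by simp
        also have "\<dots> \<le> slice k t"
          unfolding slice_def using psi sum t k C(1) k0 by (intro boxvol_mono) (auto simp: divide_right_mono)
        finally show ?thesis .
      qed
      have Ck: "0 \<le> C / real k" "C / real k \<le> d / real k" "d / real k \<le> 1 / 2"
        using C base d k0 elim(3) by (auto simp: field_simps)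
      have "(d - C) / real k * ?m = integral {C / real k..d / real k} (\<lambda>_. ?m)"
        using Ck(2) by (simp add: diff_divide_distrib)
      also have "\<dots> \<le> integral {C / real k..d / real k} (slice k)"
        using pt by (intro integral_le slice_integrable) auto
      also have "\<dots> \<le> integral {0..1/2} (slice k)"
        using Ck slice_nonneg k by (intro integral_subset_le slice_integrable) auto
      finally have I: "(d - C) / real k * ?m \<le> integral {0..1/2} (slice k)" .
      have f: "real k ^ k * exp (- real k) \<le> fact k"
        using fact_bounds(1)[of k] by (simp add: exp_minus field_simps)
      have "K * exp ((rate c - e) * real k) * 1 \<le> K * exp ((rate c - e) * real k) * real k"
        using \<open>K > 0\<close> k by (intro mult_left_mono) auto
      also have "\<dots> = (exp (rate c - e) * exp 1) ^ k * exp (- real k) * (K * real k)"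
        by (simp add: power_mult_distrib exp_minus mult.commute flip: exp_of_nat_mult)
      also have "\<dots> \<le> b ^ k * exp (- real k) * (K * real k)"
        using b \<open>K > 0\<close> k0 by (intro mult_right_mono power_mono) auto
      also have "\<dots> = (real k ^ k * exp (- real k)) * ((d - C) / real k * ?m)"
      proof -
        have "b ^ k = b ^ (k - 2) * b\<^sup>2" "real k ^ k = real k ^ (k - 2) * (real k)\<^sup>2"
          using k by (intro power_split; simp)+
        then show ?thesis using b0 k0 by (simp add: K_def field_simps power2_eq_square)
      qed
      also have "\<dots> \<le> fact k * integral {0..1/2} (slice k)"
        using f I d b0 k0 by (intro mult_mono) auto
      also have "\<dots> \<le> vol_frac k" by (rule vol_frac_bounds(1)[OF k refl])
      finally show ?case by simp
    qed
  qed
  ultimately show ?thesis by (rule that)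
qed

lemma ln_vol_frac_limit: "(\<lambda>k. ln (vol_frac k) / real k) \<longlonglongrightarrow> rate c"
proof (rule order_tendstoI)
  fix y assume "y < rate c"
  define e where "e = (rate c - y) / 2"
  have e: "0 < e" "y < rate c - e" using \<open>y < rate c\<close> by (auto simp: e_def field_simps)
  obtain K where K: "0 < K" "\<forall>\<^sub>F k in sequentially. K * exp ((rate c - e) * real k) \<le> vol_frac k"
    using vol_frac_lower[OF e(1)] .
  have "(\<lambda>k. ln K / real k + (rate c - e)) \<longlonglongrightarrow> 0 + (rate c - e)"
    by (intro tendsto_add tendsto_const lim_const_over_n)
  then have "\<forall>\<^sub>F k in sequentially. y < ln K / real k + (rate c - e)"
    by (rule order_tendstoD) (use e in simp)
  then show "\<forall>\<^sub>F k in sequentially. y < ln (vol_frac k) / real k"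
    using K(2) eventually_gt_at_top[of 0]
  proof eventually_elim
    case (elim k)
    have "ln (K * exp ((rate c - e) * real k)) \<le> ln (vol_frac k)"
      using elim(2) K(1) by (intro ln_mono) auto
    then have "(ln K + (rate c - e) * real k) / real k \<le> ln (vol_frac k) / real k"
      using K(1) by (intro divide_right_mono) (auto simp: ln_mult)
    then show ?case using elim(1,3) by (simp add: add_divide_distrib)
  qed
next
  fix y assume "rate c < y"
  obtain K where K: "0 < K" "\<And>k. 3 \<le> k \<Longrightarrow> vol_frac k \<le> K * real k ^ 4 * exp (rate c * real k)"
    using vol_frac_upper by blast
  have "(\<lambda>k. ln K / real k + 4 * (ln (real k) / real k) + rate c) \<longlonglongrightarrow> 0 + 4 * 0 + rate c"
    by (intro tendsto_add tendsto_mult tendsto_const lim_const_over_n lim_ln_over_n)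
  then have "\<forall>\<^sub>F k in sequentially. ln K / real k + 4 * (ln (real k) / real k) + rate c < y"
    by (rule order_tendstoD) (use \<open>rate c < y\<close> in simp)
  then show "\<forall>\<^sub>F k in sequentially. ln (vol_frac k) / real k < y"
    using eventually_ge_at_top[of 3]
  proof eventually_elim
    case (elim k)
    have k0: "0 < real k" using elim by simp
    have "ln (vol_frac k) \<le> ln (K * real k ^ 4 * exp (rate c * real k))"
      using K(2)[OF elim(2)] vol_frac_pos[OF elim(2)] by (intro ln_mono)
    also have "\<dots> = ln K + 4 * ln (real k) + rate c * real k"
      using K(1) k0 by (simp add: ln_mult ln_realpow)
    finally have "ln (vol_frac k) / real k \<le> (ln K + 4 * ln (real k) + rate c * real k) / real k"
      using k0 by (intro divide_right_mono) auto
    also have "\<dots> = ln K / real k + 4 * (ln (real k) / real k) + rate c"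
      using k0 by (simp add: add_divide_distrib)
    finally show ?case using elim(1) by linarith
  qed
qed

end

lemma vol_frac_powr_limit:
  assumes "(\<lambda>k. ln (vol_frac k) / real k) \<longlonglongrightarrow> L"
  shows "(\<lambda>k. vol_frac k powr (1 / real k)) \<longlonglongrightarrow> exp L"
proof (rule Lim_transform_eventually)
  show "(\<lambda>k. exp (ln (vol_frac k) / real k)) \<longlonglongrightarrow> exp L"
    using assms by (intro tendsto_exp)
  show "\<forall>\<^sub>F k in sequentially. exp (ln (vol_frac k) / real k) = vol_frac k powr (1 / real k)"
    using eventually_ge_at_top[of 3]
  proof eventually_elim
    case (elim k)
    then have "vol_frac k \<noteq> 0" using vol_frac_pos[of k] by simp
    then show ?case by (simp add: powr_def)
  qed
qed

lemma vol_frac_exp_smallo: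
  assumes "(\<lambda>k. ln (vol_frac k) / real k) \<longlonglongrightarrow> L"
  shows "\<exists>\<epsilon> :: nat \<Rightarrow> real. \<epsilon> \<in> o(\<lambda>_. 1) \<and> (\<forall>k\<ge>4. vol_frac k = exp ((L + \<epsilon> k) * real k))"
proof (intro exI conjI allI impI)
  let ?\<epsilon> = "\<lambda>k. ln (vol_frac k) / real k - L"
  have "?\<epsilon> \<longlonglongrightarrow> L - L" using assms by (intro tendsto_diff tendsto_const)
  then show "?\<epsilon> \<in> o(\<lambda>_. 1)" by (intro smalloI_tendsto) simp_all
  show "vol_frac k = exp ((L + ?\<epsilon> k) * real k)" if "4 \<le> k" for k
    using that vol_frac_pos[of k] by simp
qed

theorem propositionE1:
  shows
    "(\<forall>k N. 4 \<le> k \<and> N = k - 2 \<longrightarrow>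
        vol_frac k = real k * (real k - 1)\<^sup>2 *
          integral {0..1/2} (\<lambda>t. \<Sum>j = 0..N. (-1) ^ j * real (N choose j) *
            (max (1 - (real j + 2) * t - (real N - real j) * psi k t) 0) ^ N)) \<and>
     (\<exists>!c::real. c > 0 \<and> (1 - exp (- c)) / c = 1 - c / (exp c - 1)) \<and>
     (\<forall>c \<Lambda> \<beta> :: real.
        c > 0 \<longrightarrow>
        (1 - exp (- c)) / c = 1 - c / (exp c - 1) \<longrightarrow>
        \<Lambda> = ln c - c - 1 + (1 - exp (- c)) / c \<longrightarrow>
        \<beta> = exp \<Lambda> \<longrightarrow>
        (\<lambda>k. ln (vol_frac k) / real k) \<longlonglongrightarrow> \<Lambda> \<and>
        (\<lambda>k. vol_frac k powr (1 / real k)) \<longlonglongrightarrow> \<beta> \<and>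
        (\<exists>\<epsilon> :: nat \<Rightarrow> real. \<epsilon> \<in> o(\<lambda>_. 1) \<and>
           (\<forall>k\<ge>4. vol_frac k = exp ((\<Lambda> + \<epsilon> k) * real k))) \<and>
        1.392614330471526 \<le> c \<and> c < 1.392614330471527 \<and>
        - 1.521745139795283 < \<Lambda> \<and> \<Lambda> \<le> - 1.521745139795282 \<and>
        0.218330536985878 \<le> \<beta> \<and> \<beta> < 0.218330536985879)"
proof (intro conjI, goal_cases)
  case 1
  show ?case by (intro allI impI, rule vol_frac_formula) auto
next
  case 2
  show ?case unfolding saddle_iff by (rule saddle_point_ex1)
next
  case 3
  show ?case
  proof (intro allI impI)
    fix c \<Lambda> \<beta> :: real
    assume c: "c > 0" and eq: "(1 - exp (- c)) / c = 1 - c / (exp c - 1)"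
      and \<Lambda>: "\<Lambda> = ln c - c - 1 + (1 - exp (- c)) / c" and \<beta>: "\<beta> = exp \<Lambda>"
    have saddle: "saddle c = 1" using eq by (simp only: saddle_iff)
    have rate: "\<Lambda> = rate c" using \<Lambda> by (simp only: rate_def)
    have lim: "(\<lambda>k. ln (vol_frac k) / real k) \<longlonglongrightarrow> \<Lambda>"
      unfolding rate by (rule ln_vol_frac_limit[OF c saddle refl refl])
    have "1.392614330471526 \<le> c" "c < 1.392614330471527"
      using saddle_point_bounds[OF c saddle] by simp_all
    moreover have "- 1.521745139795283 < \<Lambda>" "\<Lambda> \<le> - 1.521745139795282"
      using rate_bounds[OF c saddle] unfolding rate by simp_all
    moreover have "0.218330536985878 \<le> \<beta>" "\<beta> < 0.218330536985879"
      using exp_rate_bounds[OF c saddle] unfolding \<beta> rate by simp_all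
    ultimately show "(\<lambda>k. ln (vol_frac k) / real k) \<longlonglongrightarrow> \<Lambda> \<and>
        (\<lambda>k. vol_frac k powr (1 / real k)) \<longlonglongrightarrow> \<beta> \<and>
        (\<exists>\<epsilon> :: nat \<Rightarrow> real. \<epsilon> \<in> o(\<lambda>_. 1) \<and>
           (\<forall>k\<ge>4. vol_frac k = exp ((\<Lambda> + \<epsilon> k) * real k))) \<and>
        1.392614330471526 \<le> c \<and> c < 1.392614330471527 \<and>
        - 1.521745139795283 < \<Lambda> \<and> \<Lambda> \<le> - 1.521745139795282 \<and>
        0.218330536985878 \<le> \<beta> \<and> \<beta> < 0.218330536985879"
      using lim vol_frac_powr_limit[OF lim] vol_frac_exp_smallo[OF lim] unfolding \<beta> by blast
  qed
qed

end
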